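(* Let $\mathcal{X}\subset\mathbb{R}^n$ be closed, $g$ a locally weakly bounded metric on $\mathcal{X}$, and let $\Phi:\mathbb{R}^n\to\mathbb{R}$ be continuously differentiable in a neighborhood of $\mathcal{X}$, with $\mathrm{grad}_g\Phi$ locally bounded on $\mathcal{X}$. Consider the projected gradient flow $$\dot x\in\Pi_{\mathcal{X}}^{g}[-\mathrm{grad}_g\Phi](x) \qquad (\ast)$$ and let $\Phi$ have compact sublevel sets on $\mathcal{X}$, i.e., for every $\ell\in\mathbb{R}$ the set $\{x\mid\Phi(x)\le\ell\}\cap\mathcal{X}$ is compact. For some $r\in\mathbb{R}$, let $\hat{\mathcal{X}}\subset\{x\in\mathcal{X}\mid\Phi(x)=r\}$ be a compact connected set of weak K-equilibria of $(\ast)$. Then the following statements hold: (i) If $\hat{\mathcal{X}}$ is locally asymptotically stable for $(\ast)$, then it is a strict set of minimizers of the problem of minimizing $\Phi(x)$ subject to $x\in\mathcal{X}$, i.e., $\Phi(y)>r$ for all $y\in\mathcal{N}\setminus\hat{\mathcal{X}}$, where $\mathcal{N}\subset\mathcal{X}$ is a (relative) neighborhood of $\hat{\mathcal{X}}$. (ii) If $\hat{\mathcal{X}}$ is a strict set of minimizers of this problem, then it is stable for $(\ast)$.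
   Context: Tangent cone: for $x\in\mathcal{X}$, $T_x\mathcal{X}$ is the set of all $v\in\mathbb{R}^n$ for which there exist $x_k\in\mathcal{X}$, $x_k\to x$, and $\delta_k\to 0^+$ with $(x_k-x)/\delta_k\to v$. Metric: a map $g$ assigning to every $x\in\mathcal{X}$ an inner product $\langle\cdot,\cdot\rangle_{g(x)}$ on $\mathbb{R}^n$, with norm $\|\cdot\|_{g(x)}$. With $\kappa_{g(x)}=\max_{\|v\|=1}\|v\|_{g(x)}/\min_{\|v\|=1}\|v\|_{g(x)}$, $g$ is locally weakly bounded if for every $x\in\mathcal{X}$ there are $\ell',L'>0$ with $\ell'\le\kappa_{g(y)}\le L'$ for all $y\in\mathcal{X}$ in a neighborhood of $x$. $\mathrm{grad}_g\Phi(x)$ is the unique vector with $\langle\mathrm{grad}_g\Phi(x),w\rangle_{g(x)}=D_x\Phi(w)$ for all $w\in\mathbb{R}^n$. Projected vector field: $\Pi_{\mathcal{X}}^{g}[f](x):=\arg\min_{v\in T_x\mathcal{X}}\|v-f(x)\|^2_{g(x)}$. Krasovskii regularization of $F:\mathcal{X}\rightrightarrows\mathbb{R}^n$: $\mathrm{K}[F](x)$ is the closed convex hull of the set of all $v$ for which there are $x_k\in\mathcal{X}$, $x_k\to x$, and $v_k\in F(x_k)$ with $v_k\to v$. A Krasovskii solution of $(\ast)$ is an absolutely continuous $x:[0,T)\to\mathcal{X}$ with $\dot x(t)\in\mathrm{K}[\Pi_{\mathcal{X}}^{g}[-\mathrm{grad}_g\Phi]](x(t))$ for almost all $t$; it is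 complete if $T=\infty$. Below, "solution" means Krasovskii solution of $(\ast)$. $x^\star\in\mathcal{X}$ is a weak K-equilibrium if $x(t)=x^\star$, $t\ge0$, is a Krasovskii solution, i.e. $0\in\mathrm{K}[\Pi_{\mathcal{X}}^{g}[-\mathrm{grad}_g\Phi]](x^\star)$. A compact set $\mathcal{A}\subset\mathcal{X}$ is stable if for every relative neighborhood $\mathcal{V}$ of $\mathcal{A}$ in $\mathcal{X}$ there is a neighborhood $\mathcal{W}$ of $\mathcal{A}$ such that every complete solution starting in $\mathcal{W}$ satisfies $x(t)\in\mathcal{V}$ for all $t\ge0$. It is locally asymptotically stable if it is stable and there is $\delta>0$ such that every (complete) solution with $d_{\mathcal{A}}(x(0))\le\delta$ satisfies $\lim_{t\to\infty}d_{\mathcal{A}}(x(t))=0$, where $d_{\mathcal{A}}$ is the Euclidean distance to $\mathcal{A}$. *)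

theory Defs
  imports "HOL-Analysis.Analysis"
begin

definition tangent_cone :: "'a::euclidean_space set \<Rightarrow> 'a \<Rightarrow> 'a set" where
  "tangent_cone X x = {v. \<exists>xs \<delta>. (\<forall>k::nat. xs k \<in> X) \<and> xs \<longlonglongrightarrow> x \<and>
      (\<forall>k. \<delta> k > (0::real)) \<and> \<delta> \<longlonglongrightarrow> 0 \<and> (\<lambda>k. (xs k - x) /\<^sub>R \<delta> k) \<longlonglongrightarrow> v}"

definition is_inner_product :: "('a::euclidean_space \<Rightarrow> 'a \<Rightarrow> real) \<Rightarrow> bool" where
  "is_inner_product B \<longleftrightarrow> bilinear B \<and> (\<forall>u v. B u v = B v u) \<and> (\<forall>v. v \<noteq> 0 \<longrightarrow> B v v > 0)"

definition metric_on :: "'a::euclidean_space set \<Rightarrow> ('a \<Rightarrow> 'a \<Rightarrow> 'a \<Rightarrow> real) \<Rightarrow> bool" where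
  "metric_on X g \<longleftrightarrow> (\<forall>x\<in>X. is_inner_product (g x))"

definition metric_norm :: "('a::euclidean_space \<Rightarrow> 'a \<Rightarrow> 'a \<Rightarrow> real) \<Rightarrow> 'a \<Rightarrow> 'a \<Rightarrow> real" where
  "metric_norm g x v = sqrt (g x v v)"

text \<open>The extrema over the unit sphere are attained when \<open>g x\<close> is an inner product, so the
  supremum and infimum below are a maximum and a minimum.\<close>

definition metric_cond :: "('a::euclidean_space \<Rightarrow> 'a \<Rightarrow> 'a \<Rightarrow> real) \<Rightarrow> 'a \<Rightarrow> real" where
  "metric_cond g x = (SUP v\<in>sphere 0 1. metric_norm g x v) / (INF v\<in>sphere 0 1. metric_norm g x v)"

definition locally_weakly_bounded ::
    "'a::euclidean_space set \<Rightarrow> ('a \<Rightarrow> 'a \<Rightarrow> 'a \<Rightarrow> real) \<Rightarrow> bool" where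
  "locally_weakly_bounded X g \<longleftrightarrow> (\<forall>x\<in>X. \<exists>l L. l > 0 \<and> L > 0 \<and>
      (\<forall>\<^sub>F y in nhds x. y \<in> X \<longrightarrow> l \<le> metric_cond g y \<and> metric_cond g y \<le> L))"

definition metric_grad ::
    "('a::euclidean_space \<Rightarrow> 'a \<Rightarrow> 'a \<Rightarrow> real) \<Rightarrow> ('a \<Rightarrow> real) \<Rightarrow> 'a \<Rightarrow> 'a" where
  "metric_grad g \<Phi> x = (THE u. \<forall>w. g x u w = frechet_derivative \<Phi> (at x) w)"

definition locally_bounded_on ::
    "'a::euclidean_space set \<Rightarrow> ('a \<Rightarrow> 'a) \<Rightarrow> bool" where
  "locally_bounded_on X f \<longleftrightarrow> (\<forall>x\<in>X. \<exists>M. \<forall>\<^sub>F y in nhds x. y \<in> X \<longrightarrow> norm (f y) \<le> M)"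

definition C1_near :: "('a::euclidean_space \<Rightarrow> real) \<Rightarrow> 'a set \<Rightarrow> bool" where
  "C1_near \<Phi> X \<longleftrightarrow> (\<exists>U (D :: 'a \<Rightarrow> 'a \<Rightarrow>\<^sub>L real). open U \<and> X \<subseteq> U \<and>
      (\<forall>x\<in>U. (\<Phi> has_derivative blinfun_apply (D x)) (at x)) \<and> continuous_on U D)"

text \<open>Set-valued: for nonconvex tangent cones the minimizer need not be unique.\<close>

definition projected_field :: "'a::euclidean_space set \<Rightarrow> ('a \<Rightarrow> 'a \<Rightarrow> 'a \<Rightarrow> real) \<Rightarrow>
    ('a \<Rightarrow> 'a) \<Rightarrow> 'a \<Rightarrow> 'a set" where
  "projected_field X g f x =
     {v. is_arg_min (\<lambda>v. (metric_norm g x (v - f x))\<^sup>2) (\<lambda>v. v \<in> tangent_cone X x) v}"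

definition krasovskii_reg ::
    "'a::euclidean_space set \<Rightarrow> ('a \<Rightarrow> 'a set) \<Rightarrow> 'a \<Rightarrow> 'a set" where
  "krasovskii_reg X F x = closure (convex hull
     {v. \<exists>xs vs. (\<forall>k::nat. xs k \<in> X) \<and> xs \<longlonglongrightarrow> x \<and> (\<forall>k. vs k \<in> F (xs k)) \<and> vs \<longlonglongrightarrow> v})"

text \<open>The usual \<open>\<epsilon>\<close>-\<open>\<delta>\<close> definition. A \<open>division_of\<close> on the real line is a finite family of
  non-overlapping compact intervals \<open>K = {Inf K..Sup K}\<close>.\<close>

definition abs_continuous_on :: "real set \<Rightarrow> (real \<Rightarrow> 'a::euclidean_space) \<Rightarrow> bool" where
  "abs_continuous_on S x \<longleftrightarrow> (\<forall>\<epsilon>>0. \<exists>\<delta>>0. \<forall>\<D> R. \<D> division_of R \<and> R \<subseteq> S \<and>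
      (\<Sum>K\<in>\<D>. Sup K - Inf K) < \<delta> \<longrightarrow> (\<Sum>K\<in>\<D>. norm (x (Sup K) - x (Inf K))) < \<epsilon>)"

text \<open>A solution on \<open>[0,T)\<close>, with \<open>T = \<infinity>\<close> allowed, of the Krasovskii regularization of \<open>F\<close>. On a
  half-open (possibly unbounded) interval, absolute continuity means absolute continuity on every
  compact subinterval. Values of \<open>x\<close> outside \<open>[0,T)\<close> are irrelevant: they can affect the two-sided
  derivative only at \<open>t = 0\<close>.\<close>

definition krasovskii_solution ::
    "'a::euclidean_space set \<Rightarrow> ('a \<Rightarrow> 'a set) \<Rightarrow> ereal \<Rightarrow> (real \<Rightarrow> 'a) \<Rightarrow> bool" where
  "krasovskii_solution X F T x \<longleftrightarrow> T > 0 \<and>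
     (\<forall>t\<ge>0. ereal t < T \<longrightarrow> x t \<in> X) \<and>
     (\<forall>b\<ge>0. ereal b < T \<longrightarrow> abs_continuous_on {0..b} x) \<and>
     (AE t in lebesgue. 0 \<le> t \<and> ereal t < T \<longrightarrow>
        (\<exists>v\<in>krasovskii_reg X F (x t). (x has_vector_derivative v) (at t)))"

abbreviation complete_solution ::
    "'a::euclidean_space set \<Rightarrow> ('a \<Rightarrow> 'a set) \<Rightarrow> (real \<Rightarrow> 'a) \<Rightarrow> bool" where
  "complete_solution X F x \<equiv> krasovskii_solution X F \<infinity> x"

definition weak_K_equilibrium ::
    "'a::euclidean_space set \<Rightarrow> ('a \<Rightarrow> 'a set) \<Rightarrow> 'a \<Rightarrow> bool" where
  "weak_K_equilibrium X F p \<longleftrightarrow> p \<in> X \<and> complete_solution X F (\<lambda>t. p)"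

lemma weak_K_equilibrium_iff:
  "weak_K_equilibrium X F p \<longleftrightarrow> p \<in> X \<and> 0 \<in> krasovskii_reg X F p"
proof -
  have ac: "abs_continuous_on S (\<lambda>t. p)" for S
    unfolding abs_continuous_on_def by (auto intro: exI[of _ 1])
  have deriv: "((\<lambda>t. p) has_vector_derivative v) (at t) \<longleftrightarrow> v = 0" for v and t :: real
    using vector_derivative_unique_at[of "\<lambda>t. p" v t 0] by auto
  have "0 \<in> krasovskii_reg X F p"
    if "AE t in lebesgue. 0 \<le> (t::real) \<longrightarrow> 0 \<in> krasovskii_reg X F p"
  proof (rule ccontr)
    assume "0 \<notin> krasovskii_reg X F p"
    with that have "AE t in lebesgue. (t::real) \<notin> {0..1}"
      by (auto elim!: eventually_mono)
    then have "{0..1::real} \<in> null_sets lebesgue"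
      by (subst AE_iff_null_sets) auto
    then show False by (auto simp: null_sets_def)
  qed
  then show ?thesis
    by (auto simp: weak_K_equilibrium_def krasovskii_solution_def ac deriv)
qed

definition rel_neighborhood :: "'a::euclidean_space set \<Rightarrow> 'a set \<Rightarrow> 'a set \<Rightarrow> bool" where
  "rel_neighborhood X A N \<longleftrightarrow> N \<subseteq> X \<and> (\<exists>U. openin (top_of_set X) U \<and> A \<subseteq> U \<and> U \<subseteq> N)"

definition stable_set ::
    "'a::euclidean_space set \<Rightarrow> ('a \<Rightarrow> 'a set) \<Rightarrow> 'a set \<Rightarrow> bool" where
  "stable_set X F A \<longleftrightarrow> (\<forall>V. rel_neighborhood X A V \<longrightarrow> (\<exists>W. rel_neighborhood X A W \<and>
      (\<forall>x. complete_solution X F x \<and> x 0 \<in> W \<longrightarrow> (\<forall>t\<ge>0. x t \<in> V))))"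

definition locally_asymptotically_stable ::
    "'a::euclidean_space set \<Rightarrow> ('a \<Rightarrow> 'a set) \<Rightarrow> 'a set \<Rightarrow> bool" where
  "locally_asymptotically_stable X F A \<longleftrightarrow> stable_set X F A \<and>
     (\<exists>\<delta>>0. \<forall>x. complete_solution X F x \<and> infdist (x 0) A \<le> \<delta> \<longrightarrow>
        ((\<lambda>t. infdist (x t) A) \<longlongrightarrow> 0) at_top)"

definition strict_minimizer_set ::
    "'a::euclidean_space set \<Rightarrow> ('a \<Rightarrow> real) \<Rightarrow> real \<Rightarrow> 'a set \<Rightarrow> bool" where
  "strict_minimizer_set X \<Phi> r A \<longleftrightarrow> (\<exists>N. rel_neighborhood X A N \<and> (\<forall>y\<in>N - A. \<Phi> y > r))"

end

theory Submission
  imports Defs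
begin

text \<open>
  A minimizer \<open>v\<close> of the \<open>g\<close>-distance to \<open>f = - grad \<Phi>\<close> over the tangent cone satisfies
  \<open>\<langle>f, v\<rangle> = \<langle>v, v\<rangle>\<close>, hence \<open>D\<Phi>(v) = - \<langle>v, v\<rangle>\<close>. Weak boundedness of the metric and local boundedness of
  the gradient turn this into \<open>\<parallel>D\<Phi>\<parallel> \<parallel>v\<parallel>\<^sup>2 \<le> - C D\<Phi>(v)\<close>. This condition is convex and closed in \<open>v\<close>
  and so passes to the Krasovskii regularization. Consequently \<open>\<Phi>\<close> is nonincreasing along
  solutions, and its derivative can vanish along a solution only at weak K-equilibria.

  Part (ii) is the classical Lyapunov argument. For part (i), a solution that starts near the
  set, but outside it, at a point where \<open>\<Phi> \<le> r\<close> converges to the set, so \<open>\<Phi> = r\<close> along it. Right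
  after the start it then visits an equilibrium that is near the set but outside it, and the constant
  solution there contradicts attractivity.

  Part (i) needs a complete solution through every point. It is a pointwise cluster point
  (Tychonoff) of Euler step functions whose steps follow tangent vectors; \<open>\<Phi>\<close> increases along
  them so little that they stay in a compact sublevel set. The cluster point is Lipschitz, hence
  differentiable almost everywhere, and separating hyperplanes show that its derivative lies in the
  Krasovskii regularization.
\<close>

subsection \<open>Lipschitz functions on the line are differentiable almost everywhere\<close>

text \<open>The metric and its gradient may jump from point to point, and tangent cones may be
  nonconvex. Estimates are therefore stated through the derivative of \<Phi>, which is continuous,
  and through half-spaces \<open>a \<bullet> w \<le> b\<close>, which survive averaging and limits.
  The factor \<open>norm (D y)\<close> in the decrease inequality is there because it absorbs the
  unknown scale of the metric. The price is that the inequality says nothing where that derivative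
  vanishes; there the projection itself is 0.

  Two levels of regularity meet. An arbitrary solution is only absolutely continuous but is
  differentiable almost everywhere by definition, so monotonicity needs just a gauge partition
  argument and no integral of a derivative. A constructed curve must earn its derivative, but it is
  Lipschitz, so differentiability almost everywhere is proved for Lipschitz functions only.

  Because X need not be convex, interpolation between Euler points could leave X. This forces step
  functions, and their jumps rule out equicontinuity; hence the pointwise compactness
  argument.\<close>

text \<open>Steps to the right from K gain \<open>q * h\<close>, and length outside K costs at most
  L per unit. Such a step may leave K at once; this is harmless for \<open>q \<ge> - L\<close>,
  because the part outside K is then charged at the lower rate.\<close>

lemma increment_ge_of_right_slopes:
  fixes f :: "real \<Rightarrow> real"
  assumes lip: "\<And>x y. \<bar>f x - f y\<bar> \<le> L * \<bar>x - y\<bar>" and K: "closed K"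
    and slope: "\<And>t \<delta>. t \<in> K \<Longrightarrow> \<delta> > 0 \<Longrightarrow> \<exists>h. 0 < h \<and> h < \<delta> \<and> f (t + h) - f t \<ge> q * h"
    and ab: "a \<le> b"
  shows "q * measure lebesgue (K \<inter> {a..b}) - L * (b - a - measure lebesgue (K \<inter> {a..b})) \<le> f b - f a"
proof -
  define m where "m x = measure lebesgue (K \<inter> {a..x})" for x
  have Kl: "K \<inter> S \<in> lmeasurable" if "S \<in> lmeasurable" for S
    by (subst Int_commute, rule fmeasurable_Int_fmeasurable[OF that]) (simp add: K borel_closed)
  have Ioc: "{x<..y} \<in> lmeasurable" for x y :: real
    by (rule bounded_set_imp_lmeasurable) (auto simp: bounded_subset[OF bounded_closed_interval[of x y]] greaterThanAtMost_subseteq_atLeastAtMost_iff)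
  have m_diff: "m y - m x = measure lebesgue (K \<inter> {x<..y})" if "a \<le> x" "x \<le> y" for x y
  proof -
    have "K \<inter> {a..y} = (K \<inter> {a..x}) \<union> (K \<inter> {x<..y})" using that by auto
    moreover have "measure lebesgue ((K \<inter> {a..x}) \<union> (K \<inter> {x<..y})) = m x + measure lebesgue (K \<inter> {x<..y})"
      unfolding m_def by (rule measure_Un2[THEN trans]) (auto simp: Kl Ioc intro!: arg_cong[where f="measure lebesgue"])
    ultimately show ?thesis by (simp add: m_def)
  qed
  have m_mono: "0 \<le> m y - m x" "m y - m x \<le> y - x" if "a \<le> x" "x \<le> y" for x y
  proof -
    show "0 \<le> m y - m x" by (simp add: m_diff that)
    have "measure lebesgue (K \<inter> {x<..y}) \<le> measure lebesgue {x<..y}"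
      by (rule measure_mono_fmeasurable) (auto intro: fmeasurableD[OF Kl] simp: Ioc)
    then show "m y - m x \<le> y - x" using that by (simp add: m_diff)
  qed
  show ?thesis
  \<comment> \<open>For \<open>q < - L\<close> the claim is weaker than the Lipschitz bound.
    Otherwise \<open>q + L \<ge> 0\<close>, which is what lets the increment of \<open>m\<close> be
    replaced by the larger step length.\<close>
  proof (cases "q \<ge> - L")
    case False
    then have "q * m b \<le> (-L) * m b"
      by (intro mult_right_mono) (auto simp: m_def)
    moreover have "- L * (b - a) \<le> f b - f a" using lip[of b a] ab by auto
    ultimately show ?thesis by (simp add: m_def algebra_simps)
  next
    case q: True
    txt \<open>Every point has arbitrarily short steps to the right along which \<open>G\<close> does not decrease: on
      \<open>K\<close> because of the slopes of \<open>f\<close>, and off the closed set \<open>K\<close> because \<open>m\<close> is locally constant.\<close>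
    define G where "G x = f x - q * m x + L * (x - m x)" for x
    have L0: "L \<ge> 0" using lip[of 1 0] by simp
    have m_lip: "\<bar>m x - m y\<bar> \<le> \<bar>x - y\<bar>" if "a \<le> x" "a \<le> y" for x y
      using m_mono[of x y] m_mono[of y x] that by (cases "x \<le> y") auto
    have "continuous_on {a..b} m"
      by (rule lipschitz_on_continuous_on[of 1], rule lipschitz_onI) (auto simp: dist_real_def m_lip)
    moreover have "continuous_on {a..b} f"
      by (rule lipschitz_on_continuous_on[of L], rule lipschitz_onI) (auto simp: dist_real_def lip L0)
    ultimately have contG: "continuous_on {a..b} G"
      unfolding G_def by (intro continuous_intros)
    have step: "\<exists>h. 0 < h \<and> h < \<delta> \<and> G (t + h) \<ge> G t" if "a \<le> t" "\<delta> > 0" for t \<delta>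
    proof (cases "t \<in> K")
      case True
      then obtain h where h: "0 < h" "h < \<delta>" "f (t + h) - f t \<ge> q * h" using slope[OF True \<open>\<delta> > 0\<close>] by blast
      have "(q + L) * (m (t + h) - m t) \<le> (q + L) * h"
        using m_mono[of t "t+h"] that h q by (intro mult_left_mono) auto
      then have "G (t + h) \<ge> G t" using h by (simp add: G_def algebra_simps)
      then show ?thesis using h by blast
    next
      case False
      then obtain e where e: "e > 0" "ball t e \<inter> K = {}"
        using K by (metis Compl_iff disjoint_eq_subset_Compl open_Compl open_contains_ball)
      define h where "h = min e \<delta> / 2"
      have h: "0 < h" "h < \<delta>" "h < e" using e that by (auto simp: h_def)
      have "K \<inter> {t<..t+h} = {}" using e h by (auto simp: ball_def dist_real_def disjoint_iff)
      then have "m (t + h) = m t" using m_diff[of t "t+h"] that h by simp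
      moreover have "f (t + h) - f t \<ge> - L * h" using lip[of "t+h" t] h by auto
      ultimately have "G (t + h) \<ge> G t" by (simp add: G_def algebra_simps)
      then show ?thesis using h by blast
    qed
    \<comment> \<open>Continuous induction: \<open>S\<close> is closed, so it contains its supremum,
      and a short step that does not decrease \<open>G\<close> would push the supremum further
      unless it is b.\<close>
    define S where "S = {x \<in> {a..b}. G a \<le> G x}"
    have "closed S" unfolding S_def
      by (intro continuous_on_closed_Collect_le contG continuous_intros)
    moreover have "a \<in> S" "S \<subseteq> {a..b}" using ab by (auto simp: S_def)
    ultimately have sup: "Sup S \<in> S"
      by (metis atLeastAtMost_iff bdd_above.I closed_contains_Sup empty_iff subset_iff)
    have "Sup S = b"
    proof (rule ccontr)
      assume "Sup S \<noteq> b"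
      then have lt: "a \<le> Sup S" "Sup S < b" using sup by (auto simp: S_def)
      then obtain h where h: "0 < h" "h < b - Sup S" "G (Sup S + h) \<ge> G (Sup S)"
        using step[of "Sup S" "b - Sup S"] by auto
      then have "Sup S + h \<in> S" using sup lt by (auto simp: S_def)
      then have "Sup S + h \<le> Sup S"
        by (rule cSup_upper) (rule bdd_above_mono[OF bdd_above_Icc \<open>S \<subseteq> {a..b}\<close>])
      then show False using h by simp
    qed
    then have "G a \<le> G b" using sup by (simp add: S_def)
    moreover have "m a = 0"
    proof -
      have "measure lebesgue (K \<inter> {a}) \<le> measure lebesgue {a}"
        by (rule measure_mono_fmeasurable) (auto intro!: fmeasurableD[OF Kl] lmeasurable_compact)
      moreover have "measure lebesgue {a} = 0"
        by (rule negligible_imp_measure0) simp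
      ultimately show ?thesis by (simp add: m_def measure_le_0_iff)
    qed
    ultimately show ?thesis by (simp add: G_def m_def algebra_simps)
  qed
qed

text \<open>Replacing f by the map from t to \<open>- f (- t)\<close> exchanges left and right
  slopes with the same q and L, and reflection preserves Lebesgue measure.\<close>

lemma increment_ge_of_left_slopes:
  fixes f :: "real \<Rightarrow> real"
  assumes lip: "\<And>x y. \<bar>f x - f y\<bar> \<le> L * \<bar>x - y\<bar>" and K: "closed K"
    and slope: "\<And>t \<delta>. t \<in> K \<Longrightarrow> \<delta> > 0 \<Longrightarrow> \<exists>h. 0 < h \<and> h < \<delta> \<and> f t - f (t - h) \<ge> q * h"
    and ab: "a \<le> b"
  shows "q * measure lebesgue (K \<inter> {a..b}) - L * (b - a - measure lebesgue (K \<inter> {a..b})) \<le> f b - f a"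
proof -
  have "uminus ` K \<inter> {- b..- a} = uminus ` (K \<inter> {a..b})" by force
  also have "measure lebesgue \<dots> = measure lebesgue (K \<inter> {a..b})"
    using measure_lebesgue_affine[of "-1" 0 "K \<inter> {a..b}"] by (simp add: image_def)
  finally have eq: "measure lebesgue (uminus ` K \<inter> {- b..- a}) = measure lebesgue (K \<inter> {a..b})" .
  have "q * measure lebesgue (uminus ` K \<inter> {- b..- a}) -
      L * (- a - (- b) - measure lebesgue (uminus ` K \<inter> {- b..- a})) \<le> - f (- (- a)) - - f (- (- b))"
  proof (rule increment_ge_of_right_slopes)
    show "\<bar>- f (- x) - - f (- y)\<bar> \<le> L * \<bar>x - y\<bar>" for x y using lip[of "-x" "-y"] by (simp add: abs_minus_commute)
    show "closed (uminus ` K)" using K by (rule closed_negations)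
    show "\<exists>h. 0 < h \<and> h < \<delta> \<and> q * h \<le> - f (- (t + h)) - - f (- t)" if "t \<in> uminus ` K" "\<delta> > 0" for t \<delta>
      using slope[of "-t" \<delta>] that by (auto simp: algebra_simps)
  qed (use ab in auto)
  then show ?thesis unfolding eq by (simp add: algebra_simps)
qed

text \<open>The sign \<open>\<sigma> = 1\<close> selects slopes to the right of \<open>t\<close>, and \<open>\<sigma> = -1\<close> slopes to the left.\<close>

definition steep_set :: "real \<Rightarrow> (real \<Rightarrow> real) \<Rightarrow> real \<Rightarrow> real set" where
  "steep_set \<sigma> f q = {t. \<forall>\<delta>>0. \<exists>h. 0 < h \<and> h < \<delta> \<and> \<sigma> * (f (t + \<sigma> * h) - f t) > q * h}"

lemma increment_ge_steep_set:
  fixes f :: "real \<Rightarrow> real"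
  assumes lip: "\<And>x y. \<bar>f x - f y\<bar> \<le> L * \<bar>x - y\<bar>" and "closed K" "K \<subseteq> steep_set \<sigma> f q"
    and "\<sigma> \<in> {1, -1}" and "a \<le> b"
  shows "q * measure lebesgue (K \<inter> {a..b}) - L * (b - a - measure lebesgue (K \<inter> {a..b})) \<le> f b - f a"
proof (cases "\<sigma> = 1")
  case True
  have "\<exists>h. 0 < h \<and> h < \<delta> \<and> q * h \<le> f (t + h) - f t" if "t \<in> K" "\<delta> > 0" for t \<delta>
    using assms(3) that True by (force simp: steep_set_def intro: less_imp_le)
  then show ?thesis
    using assms by (intro increment_ge_of_right_slopes[OF lip]) auto
next
  case False
  then have "\<sigma> = -1" using assms by auto
  then have "\<exists>h. 0 < h \<and> h < \<delta> \<and> q * h \<le> f t - f (t - h)" if "t \<in> K" "\<delta> > 0" for t \<delta>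
    using assms(3) that by (force simp: steep_set_def intro: less_imp_le)
  then show ?thesis
    using assms by (intro increment_ge_of_left_slopes[OF lip]) auto
qed

section \<open>Density estimates for sets of steep slopes\<close>

text \<open>A substitute for the density theorem: cover K by nonoverlapping intervals of total
  measure at most |K| + e. If K fills at most the fraction \<theta> of each, then |K| \<le> \<theta>
  (|K| + e), and \<theta> < 1 forces |K| = 0.\<close>

lemma negligible_if_measure_Int_interval_le:
  fixes K :: "real set"
  assumes K: "closed K" "bounded K" and \<theta>: "\<theta> < 1"
    and le: "\<And>a b. a \<le> b \<Longrightarrow> measure lebesgue (K \<inter> {a..b}) \<le> \<theta> * (b - a)"
  shows "negligible K"
proof -
  have Km: "K \<in> lmeasurable" using K by (simp add: compact_eq_bounded_closed lmeasurable_compact)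
  have \<theta>0: "\<theta> \<ge> 0" using order_trans[OF measure_nonneg le[of 0 1]] by simp
  obtain c where c: "K \<subseteq> cbox (-c) c" using bounded_subset_cbox_symmetric[OF K(2)] by blast
  have "measure lebesgue K \<le> \<theta> * (measure lebesgue K + e)" if "e > 0" for e
  proof -
    obtain \<D> where D: "countable \<D>"
        "\<And>I. I \<in> \<D> \<Longrightarrow> I \<subseteq> cbox (-c) c \<and> I \<noteq> {} \<and> (\<exists>u v. I = cbox u v)"
        "pairwise (\<lambda>A B. interior A \<inter> interior B = {}) \<D>"
        "K \<subseteq> \<Union>\<D>" "\<Union>\<D> \<in> lmeasurable" "measure lebesgue (\<Union>\<D>) \<le> measure lebesgue K + e"
      using measurable_outer_intervals_bounded[OF Km c \<open>e > 0\<close>] by metis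
    \<comment> \<open>The family may be finite. Padding its enumeration with empty sets gives one
      sequence in either case, and distinct indices never repeat a nonempty interval.\<close>
    define I where "I n = (if n \<in> to_nat_on \<D> ` \<D> then from_nat_into \<D> n else {})" for n
    have I_cases: "I n = {} \<or> I n \<in> \<D>" for n
      using D(1) by (auto simp: I_def)
    have UI: "(\<Union>n. I n) = \<Union>\<D>"
      using D(1) by (fastforce simp: I_def split: if_splits)
    have neg: "negligible (I m \<inter> I n)" if "m \<noteq> n" for m n
    proof (cases "I m = {} \<or> I n = {}")
      case False
      then have mn: "I m \<in> \<D>" "I n \<in> \<D>" using I_cases by blast+
      have "I m \<noteq> I n" using False that D(1) by (auto simp: I_def split: if_splits)
      then have "interior (I m) \<inter> interior (I n) = {}" using D(3) mn by (auto simp: pairwise_def)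
      moreover obtain u v u' v' where "I m = cbox u v" "I n = cbox u' v'" using D(2) mn by metis
      ultimately show ?thesis
        by (simp add: convex_Int negligible_convex_interior)
    qed auto
    have I_meas: "I n \<in> lmeasurable" for n
      using I_cases[of n] D(2)[of "I n"] by auto
    have bdd: "bounded (\<Union>n. I n)"
      unfolding UI using D(2) by (meson Sup_least bounded_cbox bounded_subset)
    have s1: "(\<lambda>n. measure lebesgue (I n)) sums measure lebesgue (\<Union>n. I n)"
      by (rule measure_countable_negligible_Union_bounded) (use I_meas neg bdd in \<open>auto simp: pairwise_def\<close>)
    have s2: "(\<lambda>n. measure lebesgue (K \<inter> I n)) sums measure lebesgue (\<Union>n. K \<inter> I n)"
    proof (rule measure_countable_negligible_Union_bounded)
      show "pairwise (\<lambda>m n. negligible (K \<inter> I m \<inter> (K \<inter> I n))) UNIV"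
        using neg by (auto simp: pairwise_def intro: negligible_subset)
    qed (use I_meas Km K(2) in \<open>auto intro: bounded_subset\<close>)
    have "measure lebesgue (\<Union>n. K \<inter> I n) \<le> \<theta> * measure lebesgue (\<Union>n. I n)"
    proof (rule sums_le[OF _ s2 sums_mult[OF s1]])
      fix n
      show "measure lebesgue (K \<inter> I n) \<le> \<theta> * measure lebesgue (I n)"
      proof (cases "I n = {}")
        case False
        then obtain u v where "I n = cbox u v" using I_cases D(2) by metis
        then show ?thesis using le[of u v] False by auto
      qed auto
    qed
    also have "(\<Union>n. K \<inter> I n) = K" using D(4) UI by auto
    also have "\<theta> * measure lebesgue (\<Union>n. I n) \<le> \<theta> * (measure lebesgue K + e)"
      unfolding UI using D(6) \<theta>0 by (intro mult_left_mono)
    finally show ?thesis .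
  qed
  then have *: "measure lebesgue K \<le> \<theta> * measure lebesgue K + e" if "e > 0" for e
  proof -
    have "measure lebesgue K \<le> \<theta> * (measure lebesgue K + e)"
      by (rule \<open>\<And>e. 0 < e \<Longrightarrow> measure lebesgue K \<le> \<theta> * (measure lebesgue K + e)\<close>[OF that])
    also have "\<dots> \<le> \<theta> * measure lebesgue K + e"
      using \<theta> that by (simp add: algebra_simps mult_left_le_one_le \<theta>0)
    finally show ?thesis .
  qed
  have "measure lebesgue K \<le> \<theta> * measure lebesgue K"
    by (rule field_le_epsilon) (rule *)
  then have "(1 - \<theta>) * measure lebesgue K \<le> 0"
    by (simp add: left_diff_distrib)
  then have "measure lebesgue K = 0"
    using \<theta> measure_nonneg[of lebesgue K] by (simp add: mult_le_0_iff)
  then show ?thesis by (simp add: negligible_iff_measure Km)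
qed

text \<open>For fixed h the slope condition is open in t, so the uncountable union over h is open as
  well; only the quantifier over \<delta> has to be made countable.\<close>

lemma steep_set_borel:
  assumes "continuous_on UNIV f"
  shows "steep_set \<sigma> f q \<in> sets borel"
proof -
  have eq: "steep_set \<sigma> f q = (\<Inter>n. \<Union>h\<in>{0<..<inverse (real (Suc n))}. {t. q * h < \<sigma> * (f (t + \<sigma> * h) - f t)})"
  proof (intro equalityI subsetI)
    fix t assume t: "t \<in> (\<Inter>n. \<Union>h\<in>{0<..<inverse (real (Suc n))}. {t. q * h < \<sigma> * (f (t + \<sigma> * h) - f t)})"
    show "t \<in> steep_set \<sigma> f q"
      unfolding steep_set_def mem_Collect_eq
    proof (intro allI impI)
      fix \<delta> :: real assume "\<delta> > 0"
      then obtain n where n: "inverse (real (Suc n)) < \<delta>" using reals_Archimedean by blast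
      obtain h where "0 < h" "h < inverse (real (Suc n))" "q * h < \<sigma> * (f (t + \<sigma> * h) - f t)"
        using INT_D[OF t UNIV_I, of n] by (elim UN_E) (rule that, auto)
      then show "\<exists>h>0. h < \<delta> \<and> q * h < \<sigma> * (f (t + \<sigma> * h) - f t)" using n by (intro exI[of _ h]) auto
    qed
  qed (auto simp: steep_set_def Bex_def)
  have "open {t. q * h < \<sigma> * (f (t + \<sigma> * h) - f t)}" for h
    by (intro open_Collect_less continuous_intros continuous_on_compose2[OF assms]) auto
  then show ?thesis unfolding eq by (intro sets.countable_INT'') (auto intro!: borel_open open_UN)
qed

text \<open>For a closed part K of the set, the increment bound applies to f with q and to
  \<open>- f\<close> with \<open>- p\<close>. Adding the two cancels the increments of f and leaves
  \<open>(q - p + 2 * L) * |K \<inter> I| \<le> 2 * L * |I|\<close> on every interval I, so K fills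
  at most a fixed fraction below 1 of it.\<close>

lemma negligible_steep_sets:
  fixes f :: "real \<Rightarrow> real"
  assumes lip: "\<And>x y. \<bar>f x - f y\<bar> \<le> L * \<bar>x - y\<bar>" and pq: "p < q"
    and \<sigma>: "\<sigma> \<in> {1, -1}" "\<tau> \<in> {1, -1}"
  shows "negligible (steep_set \<sigma> f q \<inter> steep_set \<tau> (\<lambda>x. - f x) (- p))" (is "negligible ?E")
proof -
  have L0: "L \<ge> 0" using lip[of 1 0] by simp
  have "continuous_on UNIV f"
    by (rule lipschitz_on_continuous_on[of L], rule lipschitz_onI) (auto simp: dist_real_def lip L0)
  then have E: "?E \<in> sets borel"
    by (intro sets.Int steep_set_borel continuous_intros)
  have neg: "negligible K" if K: "closed K" "bounded K" "K \<subseteq> ?E" for K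
  proof (rule negligible_if_measure_Int_interval_le[OF K(1,2)])
    show "2 * L / (q - p + 2 * L) < 1" using pq L0 by (simp add: field_simps)
    fix a b :: real assume ab: "a \<le> b"
    let ?m = "measure lebesgue (K \<inter> {a..b})"
    have "q * ?m - L * (b - a - ?m) \<le> f b - f a"
      by (rule increment_ge_steep_set[OF lip K(1) _ \<sigma>(1) ab]) (use K in auto)
    moreover have "- p * ?m - L * (b - a - ?m) \<le> - f b - - f a"
      by (rule increment_ge_steep_set[OF _ K(1) _ \<sigma>(2) ab])
        (use K lip in \<open>auto simp: abs_minus_commute\<close>)
    ultimately have "?m * (q - p + 2 * L) \<le> 2 * L * (b - a)" by (simp add: algebra_simps)
    then show "?m \<le> 2 * L / (q - p + 2 * L) * (b - a)"
      using pq L0 by (simp add: field_simps)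
  qed
  \<comment> \<open>Inner regularity passes from closed sets to Borel sets: a bounded piece contains
    a closed T, negligible by \<open>neg\<close>, that misses only measure e.\<close>
  have "negligible (?E \<inter> cbox (- real n) (real n))" for n
  proof -
    have meas: "?E \<inter> cbox (- real n) (real n) \<in> lmeasurable"
      using E by (intro bounded_set_imp_lmeasurable) (auto intro: bounded_subset[OF bounded_cbox])
    show ?thesis
      unfolding negligible_outer_le
    proof (intro allI impI)
      fix e :: real assume "e > 0"
      then obtain T where T: "closed T" "T \<subseteq> ?E \<inter> cbox (- real n) (real n)"
          "(?E \<inter> cbox (- real n) (real n)) - T \<in> lmeasurable"
          "emeasure lebesgue ((?E \<inter> cbox (- real n) (real n)) - T) < ennreal e"
        using sets_lebesgue_inner_closed[OF fmeasurableD[OF meas]] by metis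
      have "negligible T"
        using T bounded_subset[OF bounded_cbox, of T "- real n" "real n"] by (intro neg) auto
      then have T0: "T \<in> lmeasurable" "measure lebesgue T = 0"
        by (auto simp: negligible_imp_measurable negligible_imp_measure0)
      have "measure lebesgue (?E \<inter> cbox (- real n) (real n)) = measure lebesgue (T \<union> ((?E \<inter> cbox (- real n) (real n)) - T))"
        using T(2) by (intro arg_cong[where f = "measure lebesgue"]) blast
      also have "\<dots> \<le> measure lebesgue T + measure lebesgue ((?E \<inter> cbox (- real n) (real n)) - T)"
        by (intro measure_Un_le fmeasurableD T0 T)
      also have "\<dots> = measure lebesgue ((?E \<inter> cbox (- real n) (real n)) - T)"
        using T0 by simp
      also have "\<dots> \<le> e"
        using T(3,4) \<open>e > 0\<close> by (subst (asm) emeasure_eq_measure2) (auto simp: ennreal_less_iff less_imp_le)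
      finally show "\<exists>T. ?E \<inter> cbox (- real n) (real n) \<subseteq> T \<and> T \<in> lmeasurable \<and> measure lebesgue T \<le> e"
        using meas by blast
    qed
  qed
  then have "negligible (\<Union>n. ?E \<inter> cbox (- real n) (real n))" by (intro negligible_countable_Union) auto
  moreover have "(\<Union>n. ?E \<inter> cbox (- real n) (real n)) = ?E"
  proof (intro equalityI subsetI)
    fix t assume t: "t \<in> ?E"
    obtain n where "\<bar>t\<bar> \<le> real n" using real_arch_simple by blast
    then have "t \<in> cbox (- real n) (real n)" by auto
    with t show "t \<in> (\<Union>n. ?E \<inter> cbox (- real n) (real n))" by blast
  qed blast
  ultimately show ?thesis by simp
qed

text \<open>The difference quotients are bounded by L, so they fail to converge only if their lower
  and upper limits differ. Two rationals fit between these limits. A quotient that exceeds a level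
  arbitrarily close to t does so on at least one side, whence the two signs; rational levels make
  the exceptional sets countable in number.\<close>

lemma steep_set_if_not_differentiable:
  fixes f :: "real \<Rightarrow> real"
  assumes lip: "\<And>x y. \<bar>f x - f y\<bar> \<le> L * \<bar>x - y\<bar>" and nd: "\<not> f differentiable (at t)"
  obtains p q :: rat and \<sigma> \<tau> where "p < q" "\<sigma> \<in> {1, -1}" "\<tau> \<in> {1, -1}"
    "t \<in> steep_set \<sigma> f (of_rat q) \<inter> steep_set \<tau> (\<lambda>x. - f x) (- of_rat p)"
proof -
  define s where "s h = (f (t + h) - f t) / h" for h
  have s_le: "\<bar>s h\<bar> \<le> L" if "h \<noteq> 0" for h
    using lip[of "t + h" t] that by (simp add: s_def abs_divide divide_le_eq)
  let ?F = "at (0::real)"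
  let ?s = "\<lambda>h. ereal (s h)"
  have steep: "\<exists>\<sigma>\<in>{1,-1}. t \<in> steep_set \<sigma> g c"
    if ex: "\<exists>\<^sub>F h in ?F. (g (t + h) - g t) / h > c" for g :: "real \<Rightarrow> real" and c
  proof (rule ccontr)
    assume "\<not> ?thesis"
    then have "t \<notin> steep_set 1 g c" "t \<notin> steep_set (-1) g c" by auto
    then obtain d1 d2 where d: "d1 > 0" "d2 > 0"
      "\<And>h. 0 < h \<Longrightarrow> h < d1 \<Longrightarrow> g (t + h) - g t \<le> c * h"
      "\<And>h. 0 < h \<Longrightarrow> h < d2 \<Longrightarrow> g t - g (t - h) \<le> c * h"
      unfolding steep_set_def by simp (metis not_le)
    have "\<forall>\<^sub>F h in ?F. \<not> (g (t + h) - g t) / h > c"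
      unfolding eventually_at
    proof (intro exI[of _ "min d1 d2"] conjI ballI impI)
      fix h :: real assume "h \<noteq> 0 \<and> dist h 0 < min d1 d2"
      then show "\<not> (g (t + h) - g t) / h > c"
        using d(3)[of h] d(4)[of "-h"] by (cases "h > 0") (auto simp: field_simps)
    qed (use d in auto)
    then show False using ex by (simp add: frequently_def)
  qed
  have "Liminf ?F ?s < Limsup ?F ?s"
  proof (rule ccontr)
    assume "\<not> ?thesis"
    then have eq: "Liminf ?F ?s = Limsup ?F ?s" using Liminf_le_Limsup[of ?F ?s] by simp
    have "Limsup ?F ?s \<le> ereal L" "ereal (- L) \<le> Liminf ?F ?s"
      by (intro Limsup_bounded Liminf_bounded; use s_le in \<open>auto simp: eventually_at_filter abs_le_iff minus_le_iff\<close>)+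
    then obtain l where "Liminf ?F ?s = ereal l" "Limsup ?F ?s = ereal l"
      using eq by (cases "Limsup ?F ?s") auto
    then have "(?s \<longlongrightarrow> ereal l) ?F" by (subst tendsto_iff_Liminf_eq_Limsup) auto
    then have "DERIV f t :> l" by (simp add: s_def DERIV_def)
    then show False using nd by (simp add: real_differentiable_def)
  qed
  then obtain p where p: "Liminf ?F ?s < real_of_rat p" "real_of_rat p < Limsup ?F ?s"
    using ereal_dense3 by blast
  then obtain q where q: "real_of_rat p < ereal (real_of_rat q)" "real_of_rat q < Limsup ?F ?s"
    using ereal_dense3 by blast
  have "\<exists>\<^sub>F h in ?F. s h > of_rat q"
    unfolding frequently_def using q(2) Limsup_bounded[of "?s" "ereal (of_rat q)" ?F]
    by (auto simp: not_less)
  then obtain \<sigma> where \<sigma>: "\<sigma> \<in> {1,-1}" "t \<in> steep_set \<sigma> f (of_rat q)"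
    using steep unfolding s_def by blast
  have "\<exists>\<^sub>F h in ?F. (- f (t + h) - - f t) / h > - of_rat p"
  proof -
    have "\<exists>\<^sub>F h in ?F. s h < of_rat p"
      unfolding frequently_def using p(1) Liminf_bounded[of "ereal (of_rat p)" "?s" ?F]
      by (auto simp: not_less)
    then show ?thesis
      by (rule frequently_elim1) (simp add: s_def diff_divide_distrib)
  qed
  then obtain \<tau> where "\<tau> \<in> {1,-1}" "t \<in> steep_set \<tau> (\<lambda>x. - f x) (- of_rat p)"
    using steep[where g = "\<lambda>x. - f x"] by blast
  with \<sigma> q(1) show thesis by (intro that[of p q \<sigma> \<tau>]) (auto simp: of_rat_less)
qed

lemma lipschitz_real_differentiable_ae:
  fixes f :: "real \<Rightarrow> real"
  assumes lip: "\<And>x y. \<bar>f x - f y\<bar> \<le> L * \<bar>x - y\<bar>"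
  shows "negligible {t. \<not> f differentiable (at t)}"
proof (rule negligible_subset)
  let ?N = "\<lambda>(p :: rat, q :: rat, \<sigma>, \<tau>). steep_set \<sigma> f (of_rat q) \<inter> steep_set \<tau> (\<lambda>x. - f x) (- of_rat p)"
  let ?I = "{(p :: rat, q :: rat, \<sigma>, \<tau>). p < q \<and> \<sigma> \<in> {1, -1::real} \<and> \<tau> \<in> {1, -1::real}}"
  have "?I \<subseteq> UNIV \<times> UNIV \<times> {1,-1} \<times> {1,-1}" by auto
  then have "countable ?I" by (rule countable_subset) auto
  then show "negligible (\<Union>(?N ` ?I))"
    by (intro negligible_countable_Union countable_image)
      (auto simp: of_rat_less intro!: negligible_steep_sets[OF lip])
  show "{t. \<not> f differentiable (at t)} \<subseteq> \<Union>(?N ` ?I)"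
  proof
    fix t assume "t \<in> {t. \<not> f differentiable (at t)}"
    then have nd: "\<not> f differentiable (at t)" by simp
    show "t \<in> \<Union>(?N ` ?I)"
    proof (rule steep_set_if_not_differentiable[OF lip nd])
      fix p q \<sigma> \<tau>
      assume "p < q" "\<sigma> \<in> {1, -1}" "\<tau> \<in> {1, -1}"
        "t \<in> steep_set \<sigma> f (of_rat q) \<inter> steep_set \<tau> (\<lambda>x. - f x) (- of_rat p)"
      then show "t \<in> \<Union>(?N ` ?I)" by (intro UN_I[of "(p, q, \<sigma>, \<tau>)"]) auto
    qed
  qed
qed

lemma lipschitz_has_vector_derivative_ae:
  fixes x :: "real \<Rightarrow> 'a::euclidean_space"
  assumes lip: "\<And>s t. norm (x s - x t) \<le> L * \<bar>s - t\<bar>"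
  shows "AE t in lebesgue. \<exists>v. (x has_vector_derivative v) (at t)"
proof -
  have "negligible {t. \<not> (\<lambda>s. x s \<bullet> i) differentiable (at t)}" if "i \<in> Basis" for i
  proof (rule lipschitz_real_differentiable_ae)
    fix s t
    have "\<bar>(x s - x t) \<bullet> i\<bar> \<le> L * \<bar>s - t\<bar>"
      using Basis_le_norm[OF that, of "x s - x t"] lip[of s t] by linarith
    then show "\<bar>x s \<bullet> i - x t \<bullet> i\<bar> \<le> L * \<bar>s - t\<bar>" by (simp add: inner_diff_left)
  qed
  then have "negligible (\<Union>i\<in>Basis. {t. \<not> (\<lambda>s. x s \<bullet> i) differentiable (at t)})"
    by (intro negligible_Union finite_imageI) auto
  then have "AE t in lebesgue. t \<notin> (\<Union>i\<in>Basis. {t. \<not> (\<lambda>s. x s \<bullet> i) differentiable (at t)})"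
    by (intro AE_not_in) (simp add: negligible_iff_null_sets)
  then show ?thesis
  proof (rule eventually_mono)
    fix t assume "t \<notin> (\<Union>i\<in>Basis. {t. \<not> (\<lambda>s. x s \<bullet> i) differentiable (at t)})"
    then have "x differentiable (at t)"
      by (subst differentiable_componentwise_within) auto
    then show "\<exists>v. (x has_vector_derivative v) (at t)"
      using vector_derivative_works by blast
  qed
qed

subsection \<open>Monotonicity from the sign of the derivative\<close>

text \<open>On a partition fine for a suitable gauge, tags with derivative \<le> 0 contribute at
  most \<epsilon> times length. Tags in the null set N have their intervals inside an open set of
  measure below \<open>\<delta>0\<close>, so absolute continuity of x bounds their total. Absolute
  continuity is asked of x and carried to \<psi> by \<open>dom\<close>, which is local because
  \<psi> will be \<Phi> along a curve and \<Phi> is Lipschitz only locally.\<close>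

lemma abs_continuous_on_nonincreasing:
  fixes x :: "real \<Rightarrow> 'a::euclidean_space" and \<psi> :: "real \<Rightarrow> real"
  assumes ac: "abs_continuous_on {a..b} x" and ab: "a \<le> b" and M: "M > 0"
    and dom: "\<And>t. t \<in> {a..b} \<Longrightarrow> \<exists>\<delta>>0. \<forall>u\<in>{a..b}. \<forall>v\<in>{a..b}. \<bar>u - t\<bar> < \<delta> \<longrightarrow> \<bar>v - t\<bar> < \<delta> \<longrightarrow>
        \<bar>\<psi> v - \<psi> u\<bar> \<le> M * norm (x v - x u)"
    and der: "AE t in lebesgue. a < t \<and> t < b \<longrightarrow> (\<exists>D\<le>0. (\<psi> has_real_derivative D) (at t))"
  shows "\<psi> b \<le> \<psi> a"
proof -
  define N where "N = {t \<in> {a..b}. \<not> (\<exists>D\<le>0. (\<psi> has_real_derivative D) (at t))}"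
  have "negligible N"
  proof -
    obtain Z where Z: "Z \<in> null_sets lebesgue" 
      "{t. \<not> (a < t \<and> t < b \<longrightarrow> (\<exists>D\<le>0. (\<psi> has_real_derivative D) (at t)))} \<subseteq> Z"
      using der by (auto simp: eventually_ae_filter)
    then have "negligible (Z \<union> {a, b})" by (simp add: negligible_iff_null_sets)
    moreover have "N \<subseteq> Z \<union> {a,b}" using Z(2) by (fastforce simp: N_def subset_iff order_less_le)
    ultimately show ?thesis by (rule negligible_subset)
  qed
  then have N: "N \<in> sets lebesgue" "emeasure lebesgue N = 0"
    by (auto simp: negligible_iff_null_sets null_sets_def)
  have main: "\<psi> b - \<psi> a \<le> \<epsilon> * (b - a) + M * \<epsilon>" if \<epsilon>: "\<epsilon> > 0" for \<epsilon>
  proof -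
    obtain \<delta>0 where \<delta>0: "\<delta>0 > 0" "\<And>\<D> R. \<D> division_of R \<Longrightarrow> R \<subseteq> {a..b} \<Longrightarrow> (\<Sum>K\<in>\<D>. Sup K - Inf K) < \<delta>0 \<Longrightarrow>
        (\<Sum>K\<in>\<D>. norm (x (Sup K) - x (Inf K))) < \<epsilon>"
      using ac \<epsilon> unfolding abs_continuous_on_def by meson
    obtain O' where O': "open O'" "N \<subseteq> O'" "O' - N \<in> lmeasurable" "emeasure lebesgue (O' - N) < ennreal \<delta>0"
      using sets_lebesgue_outer_open[OF N(1) \<delta>0(1)] by metis
    have O'_less: "emeasure lebesgue O' < ennreal \<delta>0"
    proof -
      have "emeasure lebesgue O' = emeasure lebesgue (O' - N)"
        using N O'(1) by (intro emeasure_Diff_null_set[symmetric]) (auto simp: null_sets_def)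
      then show ?thesis using O'(4) by simp
    qed
    \<comment> \<open>The second clause is the straddle inequality: with u on the left and v on the
      right of t, a derivative \<open>D \<le> 0\<close> contributes
      \<open>(v - u) * D \<le> 0\<close>, so only the two remainders are left.\<close>
    define ok where "ok t e \<longleftrightarrow> (t \<in> N \<longrightarrow> ball t e \<subseteq> O' \<and> (\<forall>u\<in>{a..b}. \<forall>v\<in>{a..b}. u \<in> ball t e \<longrightarrow> v \<in> ball t e \<longrightarrow>
        \<psi> v - \<psi> u \<le> M * norm (x v - x u))) \<and>
        (t \<in> {a..b} - N \<longrightarrow> (\<forall>u\<in>ball t e. \<forall>v\<in>ball t e. u \<le> t \<longrightarrow> t \<le> v \<longrightarrow> \<psi> v - \<psi> u \<le> \<epsilon> * (v - u)))" for t e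
    have "\<exists>e>0. ok t e" for t
    proof (cases "t \<in> N")
      case True
      then have "t \<in> {a..b}" by (auto simp: N_def)
      then obtain d where d: "d > 0" "\<And>u v. u\<in>{a..b} \<Longrightarrow> v\<in>{a..b} \<Longrightarrow> \<bar>u - t\<bar> < d \<Longrightarrow> \<bar>v - t\<bar> < d \<Longrightarrow>
          \<bar>\<psi> v - \<psi> u\<bar> \<le> M * norm (x v - x u)" using dom by meson
      obtain d' where d': "d' > 0" "ball t d' \<subseteq> O'" using O'(1,2) True by (meson open_contains_ball subsetD)
      have "\<psi> v - \<psi> u \<le> M * norm (x v - x u)" if "u\<in>{a..b}" "v\<in>{a..b}" "u \<in> ball t d" "v \<in> ball t d" for u v
        using d(2)[of u v] that by (auto simp: dist_real_def abs_minus_commute)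
      then show ?thesis
        using True d(1) d' by (intro exI[of _ "min d d'"]) (auto simp: ok_def)
    next
      case False
      show ?thesis
      proof (cases "t \<in> {a..b}")
        case True
        with False obtain D where D: "D \<le> 0" "(\<psi> has_real_derivative D) (at t)" by (auto simp: N_def)
        then have "(\<psi> has_derivative (\<lambda>h. h * D)) (at t)"
          by (simp add: has_field_derivative_def mult_commute_abs)
        then obtain d where d: "d > 0" "\<And>y. \<bar>y - t\<bar> < d \<Longrightarrow> \<bar>\<psi> y - \<psi> t - (y - t) * D\<bar> \<le> \<epsilon> * \<bar>y - t\<bar>"
          using \<epsilon> unfolding has_derivative_at_alt by fastforce
        have "\<psi> v - \<psi> u \<le> \<epsilon> * (v - u)" if "u \<in> ball t d" "v \<in> ball t d" "u \<le> t" "t \<le> v" for u v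
        proof -
          have "(v - t) * D \<le> 0" "(u - t) * D \<ge> 0" using that D(1)
            by (auto intro: mult_nonneg_nonpos mult_nonpos_nonpos)
          moreover have "\<bar>\<psi> u - \<psi> t - (u - t) * D\<bar> \<le> \<epsilon> * (t - u)" "\<bar>\<psi> v - \<psi> t - (v - t) * D\<bar> \<le> \<epsilon> * (v - t)"
            using d(2)[of u] d(2)[of v] that by (auto simp: dist_real_def abs_minus_commute)
          ultimately show ?thesis by (simp add: algebra_simps)
        qed
        then show ?thesis using False d(1) by (intro exI[of _ d]) (auto simp: ok_def)
      qed (use False in \<open>auto intro: exI[of _ 1] simp: ok_def\<close>)
    qed
    then obtain e where e_pos: "e t > 0" and ok: "ok t (e t)" for t by metis
    have e: "\<And>t. e t > 0"
      "\<And>t. t \<in> N \<Longrightarrow> ball t (e t) \<subseteq> O'"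
      "\<And>t u v. t \<in> N \<Longrightarrow> u\<in>{a..b} \<Longrightarrow> v\<in>{a..b} \<Longrightarrow> u \<in> ball t (e t) \<Longrightarrow> v \<in> ball t (e t) \<Longrightarrow>
        \<psi> v - \<psi> u \<le> M * norm (x v - x u)"
      "\<And>t u v. t \<in> {a..b} - N \<Longrightarrow> u \<in> ball t (e t) \<Longrightarrow> v \<in> ball t (e t) \<Longrightarrow> u \<le> t \<Longrightarrow> t \<le> v \<Longrightarrow> 
        \<psi> v - \<psi> u \<le> \<epsilon> * (v - u)"
      using ok e_pos unfolding ok_def by blast+
    have "gauge (\<lambda>t. ball t (e t))" using e(1) by (rule gauge_ball_dependent[OF allI])
    then obtain p where p: "p tagged_division_of {a..b}" "(\<lambda>t. ball t (e t)) fine p"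
      using fine_division_exists_real by metis
    have interval: "\<exists>u v. K = {u..v} \<and> u \<le> t \<and> t \<le> v \<and> u \<in> ball t (e t) \<and> v \<in> ball t (e t) \<and> u \<in> {a..b} \<and> v \<in> {a..b} \<and> t \<in> {a..b}
        \<and> Inf K = u \<and> Sup K = v \<and> K \<subseteq> ball t (e t)"
      if tK: "(t, K) \<in> p" for t K
    proof -
      obtain u v where uv: "K = {u..v}" using tagged_division_ofD(4)[OF p(1) tK] by auto
      moreover have "t \<in> K" "K \<subseteq> {a..b}" using tagged_division_ofD(2,3)[OF p(1) tK] by auto
      moreover have "K \<subseteq> ball t (e t)" using p(2) tK by (auto simp: fine_def)
      ultimately show ?thesis
        by - (rule exI[of _ u], rule exI[of _ v], auto simp: subset_iff)
    qed
    define p1 where "p1 = {(t, K) \<in> p. t \<in> N}"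
    have fin: "finite p" using p(1) by auto
    have "p = p1 \<union> (p - p1)" "p1 \<subseteq> p" by (auto simp: p1_def)
    have "\<psi> b - \<psi> a = (\<Sum>(t,K)\<in>p. \<psi> (Sup K) - \<psi> (Inf K))"
      using additive_tagged_division_1[OF ab p(1), of \<psi>] by simp
    also have "\<dots> = (\<Sum>(t,K)\<in>p1. \<psi> (Sup K) - \<psi> (Inf K)) + (\<Sum>(t,K)\<in>p-p1. \<psi> (Sup K) - \<psi> (Inf K))"
      using sum.subset_diff[OF \<open>p1 \<subseteq> p\<close> fin] by (simp add: add.commute)
    also have "(\<Sum>(t,K)\<in>p-p1. \<psi> (Sup K) - \<psi> (Inf K)) \<le> \<epsilon> * (b - a)"
    proof -
      have "(\<Sum>(t,K)\<in>p-p1. \<psi> (Sup K) - \<psi> (Inf K)) \<le> (\<Sum>(t,K)\<in>p-p1. \<epsilon> * (Sup K - Inf K))"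
      proof (rule sum_mono, clarify)
        fix t K assume tK: "(t, K) \<in> p" "(t, K) \<notin> p1"
        then show "\<psi> (Sup K) - \<psi> (Inf K) \<le> \<epsilon> * (Sup K - Inf K)"
          using interval[OF tK(1)] e(4)[of t "Inf K" "Sup K"] by (auto simp: p1_def)
      qed
      also have "\<dots> \<le> (\<Sum>(t,K)\<in>p. \<epsilon> * (Sup K - Inf K))"
      proof (rule sum_mono2[OF fin])
        fix z assume "z \<in> p - (p - p1)"
        moreover obtain t K where "z = (t, K)" by fastforce
        ultimately show "0 \<le> (case z of (t,K) \<Rightarrow> \<epsilon> * (Sup K - Inf K))"
          using interval[of t K] \<epsilon> by auto
      qed auto
      also have "\<dots> = \<epsilon> * (\<Sum>(t,K)\<in>p. Sup K - Inf K)"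
        by (simp add: sum_distrib_left case_prod_unfold)
      also have "(\<Sum>(t,K)\<in>p. Sup K - Inf K) = b - a"
        using additive_tagged_division_1[OF ab p(1), of "\<lambda>x. x"] by simp
      finally show ?thesis .
    qed
    also have "(\<Sum>(t,K)\<in>p1. \<psi> (Sup K) - \<psi> (Inf K)) \<le> M * \<epsilon>"
    proof -
      have "p tagged_partial_division_of {a..b}" using p(1) by (simp add: tagged_division_of_def)
      then have p1: "p1 tagged_division_of \<Union>(snd ` p1)"
        by (intro tagged_partial_division_of_Union_self tagged_partial_division_subset[OF _ \<open>p1 \<subseteq> p\<close>])
      have div: "(snd ` p1) division_of \<Union>(snd ` p1)"
        by (rule division_of_tagged_division[OF p1])
      have sub: "\<Union>(snd ` p1) \<subseteq> {a..b}" "\<Union>(snd ` p1) \<subseteq> O'"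
      proof -
        have "K \<subseteq> {a..b} \<and> K \<subseteq> O'" if "K \<in> snd ` p1" for K
        proof -
          obtain t where t: "(t, K) \<in> p" "t \<in> N" using \<open>K \<in> snd ` p1\<close> by (auto simp: p1_def)
          then show ?thesis
            using tagged_division_ofD(3)[OF p(1) t(1)] interval[OF t(1)] e(2)[OF t(2)] by blast
        qed
        then show "\<Union>(snd ` p1) \<subseteq> {a..b}" "\<Union>(snd ` p1) \<subseteq> O'" by blast+
      qed
      have "(\<Sum>(t,K)\<in>p1. \<psi> (Sup K) - \<psi> (Inf K)) \<le> (\<Sum>(t,K)\<in>p1. M * norm (x (Sup K) - x (Inf K)))"
      proof (rule sum_mono, clarify)
        fix t K assume tK: "(t, K) \<in> p1"
        then have "(t, K) \<in> p" "t \<in> N" by (auto simp: p1_def)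
        then show "\<psi> (Sup K) - \<psi> (Inf K) \<le> M * norm (x (Sup K) - x (Inf K))"
          using interval[of t K] e(3)[of t "Inf K" "Sup K"] by auto
      qed
      also have "\<dots> = M * (\<Sum>(t,K)\<in>p1. norm (x (Sup K) - x (Inf K)))"
        by (simp add: sum_distrib_left case_prod_unfold)
      \<comment> \<open>Passing from tagged intervals to intervals requires a summand that vanishes
        on all boxes with empty interior. The empty box has unspecified endpoints, so it gets the
        default 0; no interval of \<open>p1\<close> is empty.\<close>
      also have "(\<Sum>(t,K)\<in>p1. norm (x (Sup K) - x (Inf K))) =
          (\<Sum>(t,K)\<in>p1. if K = {} then 0 else norm (x (Sup K) - x (Inf K)))"
        by (rule sum.cong) (use tagged_division_ofD(2)[OF p1] in fastforce)+
      also have "\<dots> = (\<Sum>K\<in>snd ` p1. if K = {} then 0 else norm (x (Sup K) - x (Inf K)))"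
      proof (rule sum.over_tagged_division_lemma[OF p1])
        show "(if cbox u v = {} then 0 else norm (x (Sup (cbox u v)) - x (Inf (cbox u v)))) = 0"
          if "box u v = {}" for u v :: real
          using that by (cases "u = v") (auto simp: not_less)
      qed
      also have "\<dots> = (\<Sum>K\<in>snd ` p1. norm (x (Sup K) - x (Inf K)))"
        by (rule sum.cong) (use tagged_division_ofD(2)[OF p1] in fastforce)+
      also have "\<dots> < \<epsilon>"
      proof (rule \<delta>0(2)[OF div sub(1)])
        have "(\<Sum>K\<in>snd ` p1. Sup K - Inf K) = (\<Sum>K\<in>snd ` p1. measure lebesgue K)"
        proof (rule sum.cong)
          fix K assume "K \<in> snd ` p1"
          then obtain t where "(t, K) \<in> p" by (auto simp: p1_def)
          from interval[OF this] obtain u v where "K = {u..v}" "u \<le> v" by force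
          then show "Sup K - Inf K = measure lebesgue K" by simp
        qed simp
        also have "\<dots> = measure lebesgue (\<Union>(snd ` p1))" by (rule content_division[OF div])
        also have "ennreal \<dots> = emeasure lebesgue (\<Union>(snd ` p1))"
          using lmeasurable_division[OF div] by (simp add: emeasure_eq_measure2)
        also have "\<dots> \<le> emeasure lebesgue O'"
          using O'(1) sub(2) by (intro emeasure_mono) auto
        also note O'_less
        finally show "(\<Sum>K\<in>snd ` p1. Sup K - Inf K) < \<delta>0"
          by (meson ennreal_leI not_le)
      qed
      finally show ?thesis using M by simp
    qed
    finally show ?thesis by simp
  qed
  have "\<psi> b - \<psi> a \<le> 0 + \<epsilon>'" if "\<epsilon>' > 0" for \<epsilon>'
  proof -
    let ?c = "b - a + M"
    have "\<epsilon>' / ?c > 0" using that ab M by simp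
    from main[OF this] have "\<psi> b - \<psi> a \<le> \<epsilon>' / ?c * ?c" by (simp add: algebra_simps add_divide_distrib diff_divide_distrib)
    then show ?thesis using ab M by simp
  qed
  then have "\<psi> b - \<psi> a \<le> 0" by (rule field_le_epsilon)
  then show ?thesis by simp
qed

subsection \<open>Metrics, tangent cones and projections\<close>

lemma is_inner_product_nonneg: "is_inner_product B \<Longrightarrow> B v v \<ge> 0"
  unfolding is_inner_product_def by (metis bilinear_lzero order_less_le order_refl)

lemma is_inner_product_Cauchy_Schwarz:
  assumes B: "is_inner_product B"
  shows "\<bar>B u w\<bar> \<le> sqrt (B u u) * sqrt (B w w)"
proof (cases "w = 0")
  case True
  then show ?thesis using B by (simp add: is_inner_product_def bilinear_rzero bilinear_lzero)
next
  case False
  have bil: "bilinear B" and sym: "B w u = B u w" and pos: "B w w > 0"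
    using B False by (auto simp: is_inner_product_def)
  define t where "t = B u w / B w w"
  have "0 \<le> B (u - t *\<^sub>R w) (u - t *\<^sub>R w)" by (rule is_inner_product_nonneg[OF B])
  also have "\<dots> = B u u - 2 * t * B u w + t\<^sup>2 * B w w"
    using bil sym by (simp add: bilinear_lsub bilinear_rsub bilinear_lmul bilinear_rmul power2_eq_square algebra_simps)
  also have "\<dots> = B u u - (B u w)\<^sup>2 / B w w"
    using pos by (simp add: t_def power2_eq_square field_simps)
  finally have "(B u w)\<^sup>2 \<le> B u u * B w w" using pos by (simp add: field_simps)
  then have "sqrt ((B u w)\<^sup>2) \<le> sqrt (B u u * B w w)" by (rule real_sqrt_le_mono)
  then show ?thesis by (simp add: real_sqrt_mult)
qed

lemma is_inner_product_continuous:
  assumes "is_inner_product B"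
  shows "continuous_on UNIV (\<lambda>v. B (v - f) (v - f))"
proof -
  have "bounded_bilinear B"
    using assms by (simp add: is_inner_product_def bilinear_conv_bounded_bilinear)
  then show ?thesis
    by (rule bounded_bilinear.continuous_on[where f = "\<lambda>v. v - f" and g = "\<lambda>v. v - f"])
      (auto intro!: continuous_intros)
qed

lemma metric_norm_scaleR:
  assumes "is_inner_product (g x)"
  shows "metric_norm g x (c *\<^sub>R v) = \<bar>c\<bar> * metric_norm g x v"
proof -
  have "g x (c *\<^sub>R v) (c *\<^sub>R v) = c\<^sup>2 * g x v v"
    using assms by (simp add: is_inner_product_def bilinear_lmul bilinear_rmul power2_eq_square)
  then show ?thesis unfolding metric_norm_def by (simp only: real_sqrt_mult real_sqrt_abs)
qed

text \<open>Here m is the minimum of the metric norm on the unit sphere. The upper bound is written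
  with \<open>metric_cond\<close> because weak boundedness controls only the ratio of the extrema,
  never m itself.\<close>

lemma metric_norm_bounds:
  fixes g :: "'a::euclidean_space \<Rightarrow> 'a \<Rightarrow> 'a \<Rightarrow> real"
  assumes B: "is_inner_product (g x)"
  obtains m where "m > 0" "\<And>v. m * norm v \<le> metric_norm g x v"
    "\<And>v. metric_norm g x v \<le> metric_cond g x * m * norm v"
proof -
  let ?S = "sphere 0 1 :: 'a set" and ?N = "metric_norm g x"
  have cont: "continuous_on ?S ?N"
    unfolding metric_norm_def using is_inner_product_continuous[OF B, of 0]
    by (intro continuous_on_real_sqrt) (auto intro: continuous_on_subset)
  have ne: "?S \<noteq> {}" by simp
  have bdd: "bdd_above (?N ` ?S)" "bdd_below (?N ` ?S)"
    using compact_imp_bounded[OF compact_continuous_image[OF cont compact_sphere]]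
    by (auto intro: bounded_imp_bdd_above bounded_imp_bdd_below)
  obtain v0 where v0: "v0 \<in> ?S" "\<And>v. v \<in> ?S \<Longrightarrow> ?N v0 \<le> ?N v"
    using continuous_attains_inf[OF compact_sphere ne cont] by blast
  define m where "m = (INF v\<in>?S. ?N v)"
  have m: "m = ?N v0"
    unfolding m_def using v0 by (intro cInf_eq_minimum) auto
  have "v0 \<noteq> 0" using v0(1) by auto
  then have m0: "m > 0" using B unfolding m metric_norm_def is_inner_product_def by auto
  have unit: "?N v = norm v * ?N (v /\<^sub>R norm v)" if "v \<noteq> 0" for v
    using that metric_norm_scaleR[of g x, OF B, of "norm v" "v /\<^sub>R norm v"] by simp
  have zero: "?N 0 = 0" using B by (simp add: metric_norm_def is_inner_product_def bilinear_lzero)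
  show thesis
  proof
    show "m > 0" by fact
    show "m * norm v \<le> ?N v" for v
    proof (cases "v = 0")
      case False
      then have "m \<le> ?N (v /\<^sub>R norm v)" unfolding m_def
        by (intro cINF_lower bdd) auto
      then have "norm v * m \<le> norm v * ?N (v /\<^sub>R norm v)" by (intro mult_left_mono) auto
      then show ?thesis using unit[OF False] by (simp add: mult.commute)
    qed (simp add: zero)
    show "?N v \<le> metric_cond g x * m * norm v" for v
    proof (cases "v = 0")
      case False
      then have "?N (v /\<^sub>R norm v) \<le> (SUP v\<in>?S. ?N v)"
        by (intro cSUP_upper bdd) auto
      also have "\<dots> = metric_cond g x * m" using m0 by (simp add: metric_cond_def m_def)
      finally have "norm v * ?N (v /\<^sub>R norm v) \<le> norm v * (metric_cond g x * m)" by (intro mult_left_mono) auto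
      then show ?thesis using unit[OF False] by (simp add: mult.commute)
    qed (simp add: zero)
  qed
qed

text \<open>Justifies the definite description in \<open>metric_grad\<close>: the coordinate map
  from u to the vector of values \<open>g x u i\<close> is injective by definiteness, hence
  surjective in finite dimension.\<close>

lemma metric_grad_eq:
  fixes g :: "'a::euclidean_space \<Rightarrow> 'a \<Rightarrow> 'a \<Rightarrow> real"
  assumes B: "is_inner_product (g x)" and D: "(\<Phi> has_derivative D) (at x)"
  shows "g x (metric_grad g \<Phi> x) w = D w"
proof -
  have bil: "bilinear (g x)" using B by (simp add: is_inner_product_def)
  have inj: "inj (\<lambda>u. \<Sum>i\<in>Basis. g x u i *\<^sub>R i)" and lin: "linear (\<lambda>u. \<Sum>i\<in>Basis. g x u i *\<^sub>R i)"
  proof -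
    show lin: "linear (\<lambda>u. \<Sum>i\<in>Basis. g x u i *\<^sub>R i)"
      using bil by (intro linearI)
        (simp_all add: bilinear_ladd bilinear_lmul scaleR_add_left sum.distrib scaleR_sum_right)
    show "inj (\<lambda>u. \<Sum>i\<in>Basis. g x u i *\<^sub>R i)"
    proof (subst linear_injective_0[OF lin], intro allI impI)
      fix u assume "(\<Sum>i\<in>Basis. g x u i *\<^sub>R i) = 0"
      then have z: "g x u i = 0" if "i \<in> Basis" for i
        using that inner_sum_left_Basis[OF that, of "g x u"] by simp
      have "linear (g x u)" using bil by (simp add: bilinear_def)
      then have "g x u u = (\<Sum>i\<in>Basis. (u \<bullet> i) * g x u i)"
        by (subst (2) euclidean_representation[symmetric]) (simp add: linear_sum linear_cmul)
      then have "g x u u = 0" using z by simp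
      then show "u = 0" using B unfolding is_inner_product_def by (metis less_irrefl)
    qed
  qed
  have "linear D" using D by (rule has_derivative_linear)
  obtain u where "(\<Sum>i\<in>Basis. D i *\<^sub>R i) = (\<Sum>i\<in>Basis. g x u i *\<^sub>R i)"
    by (rule surjE[OF linear_injective_imp_surjective[OF lin inj refl]])
  note u = this[symmetric]
  have basis: "g x u i = D i" if "i \<in> Basis" for i
    using inner_sum_left_Basis[OF that, of "g x u"] inner_sum_left_Basis[OF that, of D] u by simp
  have gD: "g x u w = D w" for w
  proof -
    have "linear (g x u)" using bil by (simp add: bilinear_def)
    then show ?thesis using linear_eq_stdbasis[OF _ \<open>linear D\<close> basis] by simp
  qed
  have fD: "frechet_derivative \<Phi> (at x) = D" using frechet_derivative_at[OF D] by simp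
  have "metric_grad g \<Phi> x = u"
    unfolding metric_grad_def fD
  proof (rule the_equality)
    fix u' assume u': "\<forall>w. g x u' w = D w"
    then have "(\<Sum>i\<in>Basis. g x u' i *\<^sub>R i) = (\<Sum>i\<in>Basis. g x u i *\<^sub>R i)" by (simp add: gD)
    then show "u' = u" using inj by (simp add: inj_def)
  qed (simp add: gD)
  then show ?thesis by (simp add: gD)
qed

lemma zero_in_tangent_cone: "x \<in> X \<Longrightarrow> 0 \<in> tangent_cone X x"
  unfolding tangent_cone_def
  by (auto intro!: exI[of _ "\<lambda>k. x"] exI[of _ "\<lambda>k. inverse (real (Suc k))"] LIMSEQ_inverse_real_of_nat)

lemma tangent_cone_scaleR:
  assumes v: "v \<in> tangent_cone X x" and c: "c > 0"
  shows "c *\<^sub>R v \<in> tangent_cone X x"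
proof -
  obtain xs \<delta> where *: "\<forall>k::nat. xs k \<in> X" "xs \<longlonglongrightarrow> x" "\<forall>k. \<delta> k > (0::real)" "\<delta> \<longlonglongrightarrow> 0"
    "(\<lambda>k. (xs k - x) /\<^sub>R \<delta> k) \<longlonglongrightarrow> v" using v unfolding tangent_cone_def by blast
  have "(\<lambda>k. c *\<^sub>R ((xs k - x) /\<^sub>R \<delta> k)) \<longlonglongrightarrow> c *\<^sub>R v"
    by (intro tendsto_intros *)
  then have "(\<lambda>k. (xs k - x) /\<^sub>R (\<delta> k / c)) \<longlonglongrightarrow> c *\<^sub>R v" by (simp add: field_simps)
  moreover have "(\<lambda>k. \<delta> k / c) \<longlonglongrightarrow> 0" using tendsto_divide[OF *(4) tendsto_const[of c]] c by simp
  ultimately show ?thesis using * c unfolding tangent_cone_def mem_Collect_eq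
    by (intro exI[of _ xs] exI[of _ "\<lambda>k. \<delta> k / c"]) auto
qed

text \<open>Trading sequences for a single pair h, y removes diagonal arguments from the closedness
  proof and supplies exactly the data of one Euler step.\<close>

lemma tangent_cone_iff:
  "v \<in> tangent_cone X x \<longleftrightarrow> (\<forall>\<epsilon>>0. \<exists>h y. 0 < h \<and> h < \<epsilon> \<and> y \<in> X \<and> norm ((y - x) /\<^sub>R h - v) < \<epsilon> \<and> norm (y - x) < \<epsilon>)"
    (is "?L \<longleftrightarrow> ?R")
proof
  assume ?L
  then obtain xs \<delta> where *: "\<forall>k::nat. xs k \<in> X" "xs \<longlonglongrightarrow> x" "\<forall>k. \<delta> k > (0::real)" "\<delta> \<longlonglongrightarrow> 0"
    "(\<lambda>k. (xs k - x) /\<^sub>R \<delta> k) \<longlonglongrightarrow> v" unfolding tangent_cone_def by blast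
  show ?R
  proof (intro allI impI)
    fix \<epsilon> :: real assume "\<epsilon> > 0"
    then have "\<forall>\<^sub>F k in sequentially. dist (xs k) x < \<epsilon> \<and> dist (\<delta> k) 0 < \<epsilon> \<and> dist ((xs k - x) /\<^sub>R \<delta> k) v < \<epsilon>"
      using * by (intro eventually_conj tendstoD)
    then obtain k where "dist (xs k) x < \<epsilon>" "dist (\<delta> k) 0 < \<epsilon>" "dist ((xs k - x) /\<^sub>R \<delta> k) v < \<epsilon>"
      using eventually_happens'[OF sequentially_bot] by blast
    then show "\<exists>h y. 0 < h \<and> h < \<epsilon> \<and> y \<in> X \<and> norm ((y - x) /\<^sub>R h - v) < \<epsilon> \<and> norm (y - x) < \<epsilon>"
      using * by (intro exI[of _ "\<delta> k"] exI[of _ "xs k"]) (auto simp: dist_norm)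
  qed
next
  assume R: ?R
  have "\<exists>h y. 0 < h \<and> h < 1 / Suc k \<and> y \<in> X \<and> norm ((y - x) /\<^sub>R h - v) < 1 / Suc k \<and> norm (y - x) < 1 / Suc k" for k
    using R by simp
  then obtain \<delta> xs where *: "\<And>k. 0 < \<delta> k" "\<And>k. \<delta> k < 1 / Suc k" "\<And>k. xs k \<in> X"
    "\<And>k. norm ((xs k - x) /\<^sub>R \<delta> k - v) < 1 / Suc k" "\<And>k. norm (xs k - x) < 1 / Suc k" by metis
  have lim: "(\<lambda>k. 1 / real (Suc k)) \<longlonglongrightarrow> 0" by (rule LIMSEQ_Suc[OF lim_1_over_n])
  show ?L unfolding tangent_cone_def mem_Collect_eq
  proof (intro exI[of _ xs] exI[of _ \<delta>] conjI allI * )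
    show "xs \<longlonglongrightarrow> x"
      by (rule LIM_zero_cancel, rule Lim_null_comparison[OF _ lim]) (use *(5) in \<open>auto intro!: always_eventually less_imp_le simp del: of_nat_Suc\<close>)
    show "\<delta> \<longlonglongrightarrow> 0"
      by (rule Lim_null_comparison[OF _ lim]) (use *(1,2) in \<open>auto intro!: always_eventually less_imp_le simp del: of_nat_Suc simp: abs_of_pos\<close>)
    show "(\<lambda>k. (xs k - x) /\<^sub>R \<delta> k) \<longlonglongrightarrow> v"
      by (rule LIM_zero_cancel, rule Lim_null_comparison[OF _ lim]) (use *(4) in \<open>auto intro!: always_eventually less_imp_le simp del: of_nat_Suc\<close>)
  qed
qed

lemma closed_tangent_cone: "closed (tangent_cone X x)"
proof (rule closure_subset_eq[THEN iffD1], rule subsetI)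
  fix v assume "v \<in> closure (tangent_cone X x)"
  then have a: "\<forall>e>0. \<exists>y\<in>tangent_cone X x. dist y v < e" by (simp add: closure_approachable)
  show "v \<in> tangent_cone X x" unfolding tangent_cone_iff
  proof (intro allI impI)
    fix \<epsilon> :: real assume "\<epsilon> > 0"
    then obtain w where w: "w \<in> tangent_cone X x" "dist w v < \<epsilon>/2" using a half_gt_zero by blast
    obtain h y where hy: "0 < h" "h < \<epsilon>/2" "y \<in> X" "norm ((y - x) /\<^sub>R h - w) < \<epsilon>/2" "norm (y - x) < \<epsilon>/2"
      using w(1) \<open>\<epsilon> > 0\<close> half_gt_zero unfolding tangent_cone_iff by blast
    have "norm ((y - x) /\<^sub>R h - v) < \<epsilon>"
      using norm_triangle_ineq[of "(y - x) /\<^sub>R h - w" "w - v"] hy(4) w(2) by (simp add: dist_norm)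
    then show "\<exists>h y. 0 < h \<and> h < \<epsilon> \<and> y \<in> X \<and> norm ((y - x) /\<^sub>R h - v) < \<epsilon> \<and> norm (y - x) < \<epsilon>"
      using hy \<open>\<epsilon> > 0\<close> by (intro exI[of _ h] exI[of _ y]) auto
  qed
qed

lemma projected_field_subset: "projected_field X g f x \<subseteq> tangent_cone X x"
  by (auto simp: projected_field_def is_arg_min_def)

lemma projected_field_nonempty:
  assumes B: "is_inner_product (g x)" and x: "x \<in> X"
  shows "projected_field X g f x \<noteq> {}"
proof -
  obtain m where m: "m > 0" "\<And>v. m * norm v \<le> metric_norm g x v" using metric_norm_bounds[of g x, OF B] by metis
  define q where "q v = g x (v - f x) (v - f x)" for v
  have q: "(metric_norm g x (v - f x))\<^sup>2 = q v" for v
    using is_inner_product_nonneg[OF B] by (simp add: metric_norm_def q_def)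
  \<comment> \<open>Beyond radius \<open>R\<close>, a vector is at least as far from
    \<open>f x\<close> as the cone element 0 in the metric norm, so the search for a minimizer may
    be confined to a compact ball.\<close>
  define R where "R = norm (f x) + metric_norm g x (0 - f x) / m"
  have R: "R \<ge> 0" using m is_inner_product_nonneg[OF B] by (simp add: R_def metric_norm_def)
  have "compact (tangent_cone X x \<inter> cball 0 R)" by (intro closed_Int_compact closed_tangent_cone compact_cball)
  moreover have "tangent_cone X x \<inter> cball 0 R \<noteq> {}" using zero_in_tangent_cone[OF x] R by auto
  moreover have "continuous_on (tangent_cone X x \<inter> cball 0 R) q"
    unfolding q_def using is_inner_product_continuous[OF B] by (rule continuous_on_subset) auto
  ultimately obtain v0 where v0: "v0 \<in> tangent_cone X x" "v0 \<in> cball 0 R" 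
    "\<And>v. v \<in> tangent_cone X x \<Longrightarrow> v \<in> cball 0 R \<Longrightarrow> q v0 \<le> q v"
    using continuous_attains_inf[of "tangent_cone X x \<inter> cball 0 R" q] by blast
  have "q v0 \<le> q v" if v: "v \<in> tangent_cone X x" for v
  proof (cases "v \<in> cball 0 R")
    case False
    then have "metric_norm g x (0 - f x) / m \<le> norm v - norm (f x)" by (simp add: R_def)
    also have "\<dots> \<le> norm (v - f x)" by (rule norm_triangle_ineq2)
    finally have "metric_norm g x (0 - f x) \<le> m * norm (v - f x)" using m(1) by (simp add: field_simps)
    also have "\<dots> \<le> metric_norm g x (v - f x)" by (rule m(2))
    finally have "q 0 \<le> q v"
      unfolding q[symmetric] using is_inner_product_nonneg[OF B] by (intro power_mono) (auto simp: metric_norm_def)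
    moreover have "q v0 \<le> q 0" using v0(3) zero_in_tangent_cone[OF x] R by simp
    ultimately show ?thesis by simp
  qed (use v v0 in auto)
  then have "v0 \<in> projected_field X g f x"
    using v0(1) by (auto simp: projected_field_def is_arg_min_def q not_less)
  then show ?thesis by blast
qed

text \<open>First-order optimality along the ray through a minimizer over a cone.\<close>

lemma projected_field_self_inner:
  assumes B: "is_inner_product (g x)" and v: "v \<in> projected_field X g f x"
  shows "g x (f x) v = g x v v"
proof -
  have bil: "bilinear (g x)" and sym: "g x v (f x) = g x (f x) v"
    using B by (auto simp: is_inner_product_def)
  have q: "(metric_norm g x (w - f x))\<^sup>2 = g x (w - f x) (w - f x)" for w
    using is_inner_product_nonneg[OF B] by (simp add: metric_norm_def)
  define a b where "a = g x v v" and "b = g x (f x) v"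
  have expand: "g x (c *\<^sub>R v - f x) (c *\<^sub>R v - f x) = c\<^sup>2 * a - 2 * c * b + g x (f x) (f x)" for c
    using bil sym by (simp add: a_def b_def bilinear_lsub bilinear_rsub bilinear_lmul bilinear_rmul
        power2_eq_square algebra_simps)
  have min: "a - 2 * b \<le> c\<^sup>2 * a - 2 * c * b" if "c > 0" for c
  proof -
    have "c *\<^sub>R v \<in> tangent_cone X x"
      using tangent_cone_scaleR[OF _ that] v by (auto simp: projected_field_def is_arg_min_def)
    then have "g x (v - f x) (v - f x) \<le> g x (c *\<^sub>R v - f x) (c *\<^sub>R v - f x)"
      using v unfolding projected_field_def is_arg_min_def mem_Collect_eq q by (auto simp: not_less)
    then show ?thesis using expand[of c] expand[of 1] by simp
  qed
  have "DERIV (\<lambda>c. c\<^sup>2 * a - 2 * c * b) 1 :> 2 * a - 2 * b"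
    by (auto intro!: derivative_eq_intros)
  \<comment> \<open>Radius 1 around c = 1 keeps c positive, so scaling by c stays in the cone and c
    = 1 is an interior minimum.\<close>
  then have "2 * a - 2 * b = 0"
    by (rule DERIV_local_min[of _ _ _ 1]) (use min in auto)
  then show ?thesis by (simp add: a_def b_def)
qed

subsection \<open>Decrease along the projected gradient field\<close>

lemma convex_norm_sq_plus_linear_le:
  fixes l :: "'a::real_inner \<Rightarrow> real"
  assumes l: "linear l" and a: "a \<ge> 0"
  shows "convex {v. a * (norm v)\<^sup>2 + l v \<le> 0}"
proof (rule convexI)
  fix x y :: 'a and u v :: real
  assume xy: "x \<in> {v. a * (norm v)\<^sup>2 + l v \<le> 0}" "y \<in> {v. a * (norm v)\<^sup>2 + l v \<le> 0}"
    and uv: "0 \<le> u" "0 \<le> v" "u + v = 1"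
  have u: "u = 1 - v" using uv by simp
  have "u * (norm x)\<^sup>2 + v * (norm y)\<^sup>2 - (norm (u *\<^sub>R x + v *\<^sub>R y))\<^sup>2 = u * v * (norm (x - y))\<^sup>2"
    unfolding u power2_norm_eq_inner
    by (simp add: inner_simps inner_commute algebra_simps power2_eq_square)
  then have "(norm (u *\<^sub>R x + v *\<^sub>R y))\<^sup>2 \<le> u * (norm x)\<^sup>2 + v * (norm y)\<^sup>2"
    using mult_nonneg_nonneg[OF mult_nonneg_nonneg[OF uv(1,2)] zero_le_power2[of "norm (x - y)"]] by linarith
  then have "a * (norm (u *\<^sub>R x + v *\<^sub>R y))\<^sup>2 \<le> a * (u * (norm x)\<^sup>2 + v * (norm y)\<^sup>2)"
    using a by (rule mult_left_mono)
  moreover have "l (u *\<^sub>R x + v *\<^sub>R y) = u * l x + v * l y"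
    using l by (simp add: linear_add linear_cmul)
  moreover have "u * (a * (norm x)\<^sup>2 + l x) \<le> 0" "v * (a * (norm y)\<^sup>2 + l y) \<le> 0"
    using xy uv by (auto intro: mult_nonneg_nonpos)
  ultimately show "u *\<^sub>R x + v *\<^sub>R y \<in> {v. a * (norm v)\<^sup>2 + l v \<le> 0}"
    by (simp add: algebra_simps)
qed

abbreviation (input) grad_field where
  "grad_field X g \<Phi> \<equiv> projected_field X g (\<lambda>x. - metric_grad g \<Phi> x)"

text \<open>The scale m of the metric cancels. Cauchy-Schwarz bounds \<open>norm D\<close> by a
  multiple of m squared, while m squared times \<open>norm w\<close> squared is at most
  \<open>g y w w = - D w\<close>. For the first bound, projection does not increase the metric norm,
  and both sides carry one factor m.\<close>

lemma projected_gradient_bounds: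
  fixes g :: "'a::euclidean_space \<Rightarrow> 'a \<Rightarrow> 'a \<Rightarrow> real" and D :: "'a \<Rightarrow>\<^sub>L real"
  assumes B: "is_inner_product (g y)" and D: "(\<Phi> has_derivative blinfun_apply D) (at y)"
    and L: "metric_cond g y \<le> L" and M: "norm (metric_grad g \<Phi> y) \<le> M"
    and w: "w \<in> grad_field X g \<Phi> y"
  shows "norm w \<le> L * M" and "norm D * (norm w)\<^sup>2 \<le> L\<^sup>2 * M * - blinfun_apply D w"
proof -
  obtain m where m: "m > 0" "\<And>v. m * norm v \<le> metric_norm g y v"
    "\<And>v. metric_norm g y v \<le> metric_cond g y * m * norm v"
    by (rule metric_norm_bounds[of g y, OF B]) (rule that)
  let ?u = "metric_grad g \<Phi> y" and ?N = "metric_norm g y"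
  have le: "?N v \<le> L * m * norm v" for v
    using m(3)[of v] L m(1) by (meson mult_right_mono norm_ge_zero order_less_imp_le order_trans)
  have N0: "?N v \<ge> 0" for v using is_inner_product_nonneg[OF B] by (simp add: metric_norm_def)
  have L0: "L \<ge> 0"
  proof -
    obtain e :: 'a where "norm e = 1" by (meson vector_choose_size zero_le_one)
    then have "0 \<le> L * m" using le[of e] N0[of e] by simp
    then show ?thesis using m(1) by (simp add: zero_le_mult_iff)
  qed
  have M0: "M \<ge> 0" using M norm_ge_zero order_trans by blast
  have bil: "bilinear (g y)" using B by (simp add: is_inner_product_def)
  have uw: "g y ?u z = D z" for z by (rule metric_grad_eq[of g y, OF B D])
  have sq: "(?N w)\<^sup>2 = - D w"
    using projected_field_self_inner[OF B w] is_inner_product_nonneg[OF B] bil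
    by (simp add: metric_norm_def bilinear_lneg uw)
  have CS: "\<bar>D z\<bar> \<le> ?N ?u * ?N z" for z
    using is_inner_product_Cauchy_Schwarz[OF B, of ?u z] by (simp add: uw metric_norm_def)
  have Nu: "?N ?u \<le> L * m * M"
    using order_trans[OF le[of ?u] mult_left_mono[OF M]] L0 m(1) by simp
  have "?N w \<le> ?N ?u"
  proof (cases "?N w = 0")
    case False
    have "?N w * ?N w \<le> ?N ?u * ?N w" using CS[of w] sq by (simp add: power2_eq_square)
    then show ?thesis using False N0[of w] by (simp add: mult_le_cancel_right)
  qed (use N0 in simp)
  then have "m * norm w \<le> m * (L * M)" using m(2)[of w] Nu by (simp add: mult_ac)
  then show "norm w \<le> L * M" using m(1) by simp
  have "norm D \<le> L\<^sup>2 * m\<^sup>2 * M"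
  proof (rule norm_blinfun_bound)
    fix z
    have "?N ?u * ?N z \<le> (L * m * M) * (L * m * norm z)"
      using Nu le[of z] N0 L0 M0 m(1) by (intro mult_mono) auto
    then show "norm (blinfun_apply D z) \<le> L\<^sup>2 * m\<^sup>2 * M * norm z"
      using CS[of z] by (simp add: power2_eq_square mult_ac)
  qed (use M0 in simp)
  then have "norm D * (norm w)\<^sup>2 \<le> L\<^sup>2 * m\<^sup>2 * M * (norm w)\<^sup>2" by (rule mult_right_mono) simp
  also have "\<dots> = L\<^sup>2 * M * (m * norm w)\<^sup>2" by (simp add: power_mult_distrib)
  also have "\<dots> \<le> L\<^sup>2 * M * (?N w)\<^sup>2"
    using m M0 by (intro mult_left_mono power_mono) auto
  finally show "norm D * (norm w)\<^sup>2 \<le> L\<^sup>2 * M * - D w" by (simp add: sq)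
qed

lemma projected_gradient_self_inner:
  assumes B: "is_inner_product (g y)" and D: "(\<Phi> has_derivative blinfun_apply D) (at y)"
    and w: "w \<in> grad_field X g \<Phi> y"
  shows "g y w w = - blinfun_apply D w"
proof -
  have "bilinear (g y)" using B by (simp add: is_inner_product_def)
  then show ?thesis
    using projected_field_self_inner[OF B w] by (simp add: bilinear_lneg metric_grad_eq[of g y, OF B D])
qed

lemma projected_gradient_nonpos:
  assumes B: "is_inner_product (g y)" and D: "(\<Phi> has_derivative blinfun_apply D) (at y)"
    and w: "w \<in> grad_field X g \<Phi> y"
  shows "blinfun_apply D w \<le> 0"
  using projected_gradient_self_inner[OF B D w] is_inner_product_nonneg[OF B, of w] by simp

lemma projected_gradient_locally_bounded:
  fixes g :: "'a::euclidean_space \<Rightarrow> 'a \<Rightarrow> 'a \<Rightarrow> real" and D :: "'a \<Rightarrow> 'a \<Rightarrow>\<^sub>L real"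
  assumes "metric_on X g" "locally_weakly_bounded X g" "locally_bounded_on X (metric_grad g \<Phi>)"
    and D: "\<And>y. y \<in> X \<Longrightarrow> (\<Phi> has_derivative blinfun_apply (D y)) (at y)" and x: "x \<in> X"
  obtains C where "C > 0" "\<forall>\<^sub>F y in nhds x. y \<in> X \<longrightarrow> (\<forall>w\<in>grad_field X g \<Phi> y.
      norm w \<le> C \<and> norm (D y) * (norm w)\<^sup>2 \<le> C * - blinfun_apply (D y) w)"
proof -
  obtain L where L: "\<forall>\<^sub>F y in nhds x. y \<in> X \<longrightarrow> metric_cond g y \<le> L"
  proof -
    obtain l L where "\<forall>\<^sub>F y in nhds x. y \<in> X \<longrightarrow> l \<le> metric_cond g y \<and> metric_cond g y \<le> L"
      using assms(2) x unfolding locally_weakly_bounded_def by blast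
    then have "\<forall>\<^sub>F y in nhds x. y \<in> X \<longrightarrow> metric_cond g y \<le> L" by (rule eventually_mono) blast
    then show thesis by (rule that)
  qed
  obtain M where M: "\<forall>\<^sub>F y in nhds x. y \<in> X \<longrightarrow> norm (metric_grad g \<Phi> y) \<le> M"
    using assms(3) x unfolding locally_bounded_on_def by blast
  \<comment> \<open>One constant serves both estimates, and the summand 1 makes it positive.
    Enlarging the constant in the second estimate is legitimate because
    \<open>- D w \<ge> 0\<close>.\<close>
  define C where "C = \<bar>L * M\<bar> + \<bar>L\<^sup>2 * M\<bar> + 1"
  show thesis
  proof
    show "C > 0" by (simp add: C_def)
    show "\<forall>\<^sub>F y in nhds x. y \<in> X \<longrightarrow> (\<forall>w\<in>grad_field X g \<Phi> y.
      norm w \<le> C \<and> norm (D y) * (norm w)\<^sup>2 \<le> C * - blinfun_apply (D y) w)"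
      using L M
    proof eventually_elim
      case (elim y)
      show ?case
      proof (intro impI ballI)
        fix w assume y: "y \<in> X" and w: "w \<in> grad_field X g \<Phi> y"
        have B: "is_inner_product (g y)" using assms(1) y by (simp add: metric_on_def)
        have "L\<^sup>2 * M * - D y w \<le> C * - D y w"
          using projected_gradient_nonpos[OF B D[OF y] w] by (intro mult_right_mono) (auto simp: C_def)
        moreover have "L * M \<le> C" by (simp add: C_def)
        ultimately show "norm w \<le> C \<and> norm (D y) * (norm w)\<^sup>2 \<le> C * - blinfun_apply (D y) w"
          using projected_gradient_bounds[OF B D[OF y] _ _ w] elim y by (meson order_trans)
      qed
    qed
  qed
qed

text \<open>The inequality mentions neither the metric nor its gradient, only D and C. Since D is
  continuous and C is fixed near x, it passes to limits of field values at nearby points.\<close>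

lemma krasovskii_projected_gradient:
  fixes g :: "'a::euclidean_space \<Rightarrow> 'a \<Rightarrow> 'a \<Rightarrow> real" and D :: "'a \<Rightarrow> 'a \<Rightarrow>\<^sub>L real"
  assumes "metric_on X g" "locally_weakly_bounded X g" "locally_bounded_on X (metric_grad g \<Phi>)"
    and D: "\<And>y. y \<in> X \<Longrightarrow> (\<Phi> has_derivative blinfun_apply (D y)) (at y)"
    and D_cont: "continuous_on X D" and x: "x \<in> X"
  obtains C where "C > 0"
    "\<And>v. v \<in> krasovskii_reg X (grad_field X g \<Phi>) x \<Longrightarrow> norm (D x) * (norm v)\<^sup>2 \<le> C * - blinfun_apply (D x) v"
proof -
  obtain C where C: "C > 0" and ev: "\<forall>\<^sub>F y in nhds x. y \<in> X \<longrightarrow> (\<forall>w\<in>grad_field X g \<Phi> y.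
      norm w \<le> C \<and> norm (D y) * (norm w)\<^sup>2 \<le> C * - blinfun_apply (D y) w)"
    by (rule projected_gradient_locally_bounded[OF assms(1-3) D x])
  let ?S = "{v. norm (D x) * (norm v)\<^sup>2 + C * D x v \<le> 0}"
  have "{v. \<exists>xs vs. (\<forall>k::nat. xs k \<in> X) \<and> xs \<longlonglongrightarrow> x \<and> (\<forall>k. vs k \<in> grad_field X g \<Phi> (xs k)) \<and> vs \<longlonglongrightarrow> v} \<subseteq> ?S"
  proof clarify
    fix v xs vs assume *: "\<forall>k::nat. xs k \<in> X" "xs \<longlonglongrightarrow> x" "\<forall>k. vs k \<in> grad_field X g \<Phi> (xs k)" "vs \<longlonglongrightarrow> v"
    have Dl: "(\<lambda>k. D (xs k)) \<longlonglongrightarrow> D x"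
      using D_cont x * unfolding continuous_on_sequentially comp_def by blast
    have "(\<lambda>k. norm (D (xs k)) * (norm (vs k))\<^sup>2 + C * D (xs k) (vs k)) \<longlonglongrightarrow> norm (D x) * (norm v)\<^sup>2 + C * D x v"
      by (intro tendsto_intros Dl *)
    moreover have "\<forall>\<^sub>F k in sequentially. norm (D (xs k)) * (norm (vs k))\<^sup>2 + C * D (xs k) (vs k) \<le> 0"
      using eventually_compose_filterlim[OF ev *(2)]
    proof eventually_elim
      case (elim k)
      then have "norm (D (xs k)) * (norm (vs k))\<^sup>2 \<le> C * - D (xs k) (vs k)" using *(1,3) by blast
      then show ?case by simp
    qed
    ultimately show "norm (D x) * (norm v)\<^sup>2 + C * D x v \<le> 0"
      by (rule tendsto_upperbound) auto
  qed
  moreover have "convex ?S"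
    by (rule convex_norm_sq_plus_linear_le)
      (auto intro!: linearI simp: blinfun.add_right blinfun.scaleR_right algebra_simps)
  moreover have "closed ?S"
    by (intro closed_Collect_le continuous_intros)
  ultimately have "krasovskii_reg X (grad_field X g \<Phi>) x \<subseteq> ?S"
    unfolding krasovskii_reg_def by (intro closure_minimal hull_minimal)
  then show thesis using C by (intro that[of C]) auto
qed

lemma subset_krasovskii_reg: "x \<in> X \<Longrightarrow> F x \<subseteq> krasovskii_reg X F x"
  unfolding krasovskii_reg_def
  by (rule order_trans[OF _ order_trans[OF hull_subset closure_subset]]) (auto intro!: exI[of _ "\<lambda>_. x"] exI[of _ "\<lambda>_. _"])

text \<open>A hyperplane that strictly separates v from the regularization at x must already bound F
  at all points of X near x. Otherwise field values on the wrong side, being bounded, would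
  accumulate at a member of the regularization. This replaces the closed convex hull by linear
  inequalities on F itself, which can be summed over Euler steps.\<close>

lemma krasovskii_reg_separation:
  assumes x: "x \<in> X" and bdd: "\<forall>\<^sub>F y in nhds x. y \<in> X \<longrightarrow> (\<forall>w\<in>F y. norm w \<le> C)"
    and v: "v \<notin> krasovskii_reg X F x"
  obtains a b where "a \<bullet> v > b" "\<forall>\<^sub>F y in nhds x. y \<in> X \<longrightarrow> (\<forall>w\<in>F y. a \<bullet> w \<le> b)"
proof -
  have "convex (krasovskii_reg X F x)" "closed (krasovskii_reg X F x)"
    unfolding krasovskii_reg_def by (auto intro: convex_closure convex_convex_hull)
  then obtain a b where ab: "a \<bullet> v < b" "\<And>w. w \<in> krasovskii_reg X F x \<Longrightarrow> a \<bullet> w > b"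
    using separating_hyperplane_closed_point v by metis
  have "\<forall>\<^sub>F y in nhds x. y \<in> X \<longrightarrow> (\<forall>w\<in>F y. - a \<bullet> w \<le> - b)"
  proof (rule ccontr)
    assume "\<not> ?thesis"
    then have freq: "\<exists>\<^sub>F y in nhds x. y \<in> X \<and> (\<exists>w\<in>F y. a \<bullet> w < b)"
      by (auto simp: not_eventually not_le elim: frequently_elim1)
    have "\<exists>y w. dist y x < 1 / Suc k \<and> y \<in> X \<and> w \<in> F y \<and> a \<bullet> w < b \<and> norm w \<le> C" for k
    proof -
      have "\<forall>\<^sub>F y in nhds x. dist y x < 1 / Suc k"
        unfolding eventually_nhds_metric by (intro exI[of _ "1 / Suc k"]) auto
      with bdd have near: "\<forall>\<^sub>F y in nhds x. dist y x < 1 / Suc k \<and> (y \<in> X \<longrightarrow> (\<forall>w\<in>F y. norm w \<le> C))"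
        by eventually_elim auto
      show ?thesis
        using frequently_ex[OF frequently_eventually_frequently[OF freq near]] by blast
    qed
    then obtain ys ws where *: "\<And>k. dist (ys k) x < 1 / Suc k" "\<And>k. ys k \<in> X" "\<And>k. ws k \<in> F (ys k)"
      "\<And>k. a \<bullet> ws k < b" "\<And>k. norm (ws k) \<le> C" by metis
    have "ws k \<in> cball 0 C" for k using * by simp
    then obtain w r where r: "strict_mono r" "(ws \<circ> r) \<longlonglongrightarrow> w"
      using compact_cball[of 0 C, unfolded compact_def] by blast
    have "ys \<longlonglongrightarrow> x"
      by (subst tendsto_dist_iff, rule Lim_null_comparison[OF _ LIMSEQ_Suc[OF lim_1_over_n]])
        (use *(1) in \<open>auto intro!: always_eventually less_imp_le simp del: of_nat_Suc\<close>)
    then have "(ys \<circ> r) \<longlonglongrightarrow> x" using r(1) by (rule LIMSEQ_subseq_LIMSEQ)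
    then have "w \<in> krasovskii_reg X F x"
      unfolding krasovskii_reg_def using r *(2,3)
      by (intro subsetD[OF order_trans[OF hull_subset closure_subset]] CollectI exI[of _ "ys \<circ> r"] exI[of _ "ws \<circ> r"]) auto
    then have "a \<bullet> w > b" by (rule ab(2))
    moreover have "a \<bullet> w \<le> b"
      by (rule tendsto_upperbound[OF tendsto_inner[OF tendsto_const r(2)]])
        (use *(4) in \<open>auto intro!: always_eventually less_imp_le\<close>)
    ultimately show False by simp
  qed
  then show thesis using ab(1) by (intro that[of "-b" "-a"]) auto
qed

subsection \<open>Existence of complete solutions\<close>

lemma locally_bounded_field_compact:
  fixes F :: "'a::euclidean_space \<Rightarrow> 'a set"
  assumes K: "compact K" "K \<subseteq> X"
    and bdd: "\<And>x. x \<in> X \<Longrightarrow> \<exists>C. \<forall>\<^sub>F y in nhds x. y \<in> X \<longrightarrow> (\<forall>w\<in>F y. norm w \<le> C)"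
  obtains C where "C \<ge> 0" "\<And>y w. y \<in> K \<Longrightarrow> w \<in> F y \<Longrightarrow> norm w \<le> C"
proof -
  have "\<exists>U C. open U \<and> x \<in> U \<and> (\<forall>y\<in>U \<inter> X. \<forall>w\<in>F y. norm w \<le> C)" if x: "x \<in> K" for x
  proof -
    have "x \<in> X" using x K by blast
    then obtain C where "\<forall>\<^sub>F y in nhds x. y \<in> X \<longrightarrow> (\<forall>w\<in>F y. norm w \<le> C)" using bdd by blast
    then show ?thesis unfolding eventually_nhds by blast
  qed
  then obtain U C where UC: "\<And>x. x \<in> K \<Longrightarrow> open (U x) \<and> x \<in> U x \<and> (\<forall>y\<in>U x \<inter> X. \<forall>w\<in>F y. norm w \<le> C x)"
    by metis
  obtain T where T: "T \<subseteq> K" "finite T" "K \<subseteq> (\<Union>x\<in>T. U x)"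
    using compactE_image[OF K(1), of K U] UC by blast
  show thesis
  proof
    show "(\<Sum>x\<in>T. \<bar>C x\<bar>) \<ge> 0" by (simp add: sum_nonneg)
    fix y w assume y: "y \<in> K" and w: "w \<in> F y"
    then obtain x where x: "x \<in> T" "y \<in> U x" using T(3) by blast
    then have "norm w \<le> C x" using UC[of x] T(1) K(2) y w by blast
    also have "\<dots> \<le> \<bar>C x\<bar>" by simp
    also have "\<dots> \<le> (\<Sum>x\<in>T. \<bar>C x\<bar>)" by (rule member_le_sum[OF x(1)]) (use T(2) in auto)
    finally show "norm w \<le> (\<Sum>x\<in>T. \<bar>C x\<bar>)" .
  qed
qed

text \<open>A tangent direction is realized by points of X up to first order, so a direction of
  nonpositive derivative raises \<Phi> by at most a small multiple of h. All bounds are strict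
  because they must persist when x is moved slightly.\<close>

lemma tangent_descent_step:
  fixes D :: "'a::euclidean_space \<Rightarrow>\<^sub>L real"
  assumes w: "w \<in> tangent_cone X x" and D: "(\<Phi> has_derivative blinfun_apply D) (at x)"
    and desc: "blinfun_apply D w \<le> 0" and \<epsilon>: "\<epsilon> > 0"
  obtains h y where "0 < h" "h < \<epsilon>" "y \<in> X" "norm (y - x - h *\<^sub>R w) < \<epsilon> * h" "\<Phi> y - \<Phi> x < \<epsilon> * h"
proof -
  \<comment> \<open>The actual direction q has norm at most \<open>norm w + 1\<close>, so this
    choice keeps the differentiation remainder below \<open>h * \<epsilon> / 4\<close>.\<close>
  define \<eta> where "\<eta> = \<epsilon> / (4 * (norm w + 1))"
  have \<eta>: "\<eta> > 0" "\<eta> * (norm w + 1) = \<epsilon> / 4"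
    using \<epsilon> by (auto simp: \<eta>_def add_nonneg_eq_0_iff divide_simps add_pos_nonneg add_nonneg_pos)
  obtain d where d: "d > 0" "\<And>z. norm (z - x) < d \<Longrightarrow> norm (\<Phi> z - \<Phi> x - D (z - x)) \<le> \<eta> * norm (z - x)"
    using D \<eta>(1) unfolding has_derivative_at_alt by meson
  \<comment> \<open>The last entry bounds \<open>D (q - w)\<close> by \<epsilon> / 4, the entry 1
    bounds \<open>norm q\<close>, and d keeps y where the differentiation estimate holds. Together
    the errors use half of \<epsilon>, which leaves strictness.\<close>
  define \<epsilon>' where "\<epsilon>' = min (min \<epsilon> d) (min 1 (\<epsilon> / (4 * (norm D + 1))))"
  have nD: "norm D + 1 > 0" by (simp add: add_nonneg_pos)
  have \<epsilon>': "\<epsilon>' > 0" "\<epsilon>' \<le> \<epsilon>" "\<epsilon>' \<le> d" "\<epsilon>' \<le> 1" "\<epsilon>' \<le> \<epsilon> / (4 * (norm D + 1))"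
    using \<epsilon> d(1) nD by (auto simp: \<epsilon>'_def)
  obtain h y where hy: "0 < h" "h < \<epsilon>'" "y \<in> X" "norm ((y - x) /\<^sub>R h - w) < \<epsilon>'" "norm (y - x) < \<epsilon>'"
    using w \<epsilon>'(1) unfolding tangent_cone_iff by meson
  define q where "q = (y - x) /\<^sub>R h"
  have q: "y - x = h *\<^sub>R q" "norm (q - w) < \<epsilon>'" using hy by (auto simp: q_def)
  show thesis
  proof
    show "0 < h" "h < \<epsilon>" "y \<in> X" using hy \<epsilon>' by auto
    have "y - x - h *\<^sub>R w = h *\<^sub>R (q - w)" by (simp add: q(1) scaleR_diff_right)
    then have "norm (y - x - h *\<^sub>R w) = h * norm (q - w)" using hy(1) by simp
    also have "\<dots> < h * \<epsilon>" using q(2) hy(1) \<epsilon>'(2) by (intro mult_strict_left_mono) auto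
    finally show "norm (y - x - h *\<^sub>R w) < \<epsilon> * h" by (simp add: mult.commute)
    have "norm q \<le> norm w + norm (q - w)" by (metis add.commute norm_triangle_sub)
    then have nq: "norm q \<le> norm w + 1" using q(2) \<epsilon>'(4) by simp
    have "D (q - w) \<le> norm D * norm (q - w)" using norm_blinfun[of D "q - w"] by simp
    also have "\<dots> \<le> (norm D + 1) * \<epsilon>'" using q(2) \<epsilon>'(1) by (intro mult_mono) auto
    also have "\<dots> \<le> (norm D + 1) * (\<epsilon> / (4 * (norm D + 1)))" using \<epsilon>'(5) nD by (intro mult_left_mono) auto
    also have "\<dots> = \<epsilon> / 4" using nD by (simp only: times_divide_eq_right mult.commute[of 4] mult_divide_mult_cancel_left_if) simp
    finally have Dq: "D q \<le> \<epsilon> / 4" using desc by (simp add: blinfun.diff_right)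
    have "\<Phi> y - \<Phi> x \<le> D (y - x) + \<eta> * norm (y - x)"
      using d(2)[of y] hy(5) \<epsilon>'(3) by (auto simp: abs_le_iff)
    also have "\<dots> = h * (D q + \<eta> * norm q)"
      using hy(1) by (simp add: q(1) blinfun.scaleR_right algebra_simps)
    also have "\<dots> \<le> h * (\<epsilon> / 4 + \<epsilon> / 4)"
      using Dq \<eta>(2) mult_left_mono[OF nq, of \<eta>] \<eta>(1) hy(1) by (intro mult_left_mono add_mono) auto
    also have "\<dots> < \<epsilon> * h" using hy(1) \<epsilon> by simp
    finally show "\<Phi> y - \<Phi> x < \<epsilon> * h" .
  qed
qed

text \<open>Compactness bounds the step length below, so finitely many Euler steps cover any time span.\<close>

lemma uniform_descent_step:
  fixes D :: "'a::euclidean_space \<Rightarrow> 'a \<Rightarrow>\<^sub>L real"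
  assumes K: "compact K" "K \<subseteq> X" and \<epsilon>: "\<epsilon> > 0"
    and ne: "\<And>x. x \<in> X \<Longrightarrow> F x \<noteq> {}" and tan: "\<And>x. x \<in> X \<Longrightarrow> F x \<subseteq> tangent_cone X x"
    and D: "\<And>x. x \<in> X \<Longrightarrow> (\<Phi> has_derivative blinfun_apply (D x)) (at x)"
    and desc: "\<And>x w. x \<in> X \<Longrightarrow> w \<in> F x \<Longrightarrow> blinfun_apply (D x) w \<le> 0"
  obtains \<eta> where "\<eta> > 0" "\<eta> \<le> \<epsilon>" "\<And>x. x \<in> K \<Longrightarrow> \<exists>h y z w. \<eta> \<le> h \<and> h \<le> \<epsilon> \<and> y \<in> X \<and> z \<in> K \<and> norm (z - x) < \<epsilon> \<and> w \<in> F z \<and>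
    norm (y - x - h *\<^sub>R w) \<le> \<epsilon> * h \<and> \<Phi> y - \<Phi> x \<le> \<epsilon> * h"
proof -
  \<comment> \<open>One step chosen at z serves all x in a neighborhood. F may jump between z and x,
    so the direction stays credited to z, and the distance from z to x becomes part of the
    error.\<close>
  have "\<exists>U h y w. open U \<and> z \<in> U \<and> 0 < h \<and> h < \<epsilon> \<and> y \<in> X \<and> w \<in> F z \<and>
      (\<forall>x\<in>U. norm (z - x) < \<epsilon> \<and> norm (y - x - h *\<^sub>R w) < \<epsilon> * h \<and> \<Phi> y - \<Phi> x < \<epsilon> * h)" if "z \<in> K" for z
  proof -
    have z: "z \<in> X" using that K by blast
    obtain w where w: "w \<in> F z" using ne[OF z] by blast
    obtain h y where hy: "0 < h" "h < \<epsilon>" "y \<in> X" "norm (y - z - h *\<^sub>R w) < \<epsilon> * h" "\<Phi> y - \<Phi> z < \<epsilon> * h"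
      using tangent_descent_step[OF _ D[OF z] desc[OF z w] \<epsilon>] tan[OF z] w by blast
    have "isCont \<Phi> z" using D[OF z] by (rule has_derivative_continuous)
    then have \<Phi>z: "(\<Phi> \<longlongrightarrow> \<Phi> z) (nhds z)" by (simp add: isCont_def tendsto_nhds_iff continuous_at)
    have lims: "((\<lambda>x. norm (z - x)) \<longlongrightarrow> norm (z - z)) (nhds z)"
      "((\<lambda>x. norm (y - x - h *\<^sub>R w)) \<longlongrightarrow> norm (y - z - h *\<^sub>R w)) (nhds z)"
      "((\<lambda>x. \<Phi> y - \<Phi> x) \<longlongrightarrow> \<Phi> y - \<Phi> z) (nhds z)"
      by (intro tendsto_intros \<Phi>z filterlim_ident)+
    then have "\<forall>\<^sub>F x in nhds z. norm (z - x) < \<epsilon> \<and> norm (y - x - h *\<^sub>R w) < \<epsilon> * h \<and> \<Phi> y - \<Phi> x < \<epsilon> * h"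
      using hy \<epsilon> by (intro eventually_conj lims[THEN order_tendstoD(2)]) auto
    then show ?thesis unfolding eventually_nhds using hy w by blast
  qed
  then obtain U h y w where UC: "\<And>z. z \<in> K \<Longrightarrow> open (U z) \<and> z \<in> U z \<and> 0 < h z \<and> h z < \<epsilon> \<and> y z \<in> X \<and> w z \<in> F z \<and>
      (\<forall>x\<in>U z. norm (z - x) < \<epsilon> \<and> norm (y z - x - h z *\<^sub>R w z) < \<epsilon> * h z \<and> \<Phi> (y z) - \<Phi> x < \<epsilon> * h z)"
    by metis
  obtain T where T: "T \<subseteq> K" "finite T" "K \<subseteq> (\<Union>x\<in>T. U x)"
    using compactE_image[OF K(1), of K U] UC by blast
  show thesis
  proof
    \<comment> \<open>Inserting \<epsilon> keeps the minimum meaningful when T is empty and gives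
      the upper bound at once.\<close>
    show "Min (insert \<epsilon> (h ` T)) > 0" "Min (insert \<epsilon> (h ` T)) \<le> \<epsilon>" using T UC \<epsilon> by auto
    fix x assume "x \<in> K"
    then obtain z where z: "z \<in> T" "x \<in> U z" using T(3) by blast
    then have "z \<in> K" using T by blast
    have "Min (insert \<epsilon> (h ` T)) \<le> h z" using T(2) z(1) by (intro Min_le) auto
    then show "\<exists>h' y z w. Min (insert \<epsilon> (h ` T)) \<le> h' \<and> h' \<le> \<epsilon> \<and> y \<in> X \<and> z \<in> K \<and> norm (z - x) < \<epsilon> \<and> w \<in> F z \<and>
      norm (y - x - h' *\<^sub>R w) \<le> \<epsilon> * h' \<and> \<Phi> y - \<Phi> x \<le> \<epsilon> * h'"
      using UC[OF \<open>z \<in> K\<close>] z(2) \<open>z \<in> K\<close>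
      by - (rule exI[of _ "h z"], rule exI[of _ "y z"], rule exI[of _ z], rule exI[of _ "w z"], simp add: less_imp_le)
  qed
qed

text \<open>The value of \<Phi> grows by at most \<epsilon> per unit of time. Up to time
  1/\<epsilon> it stays below c + 1, and one further step adds at most 1, which is why the sublevel
  is c + 2. After that time the position is frozen; the horizon 1/\<epsilon> exceeds any given time
  once \<epsilon> is small.\<close>

lemma euler_polygon:
  fixes D :: "'a::euclidean_space \<Rightarrow> 'a \<Rightarrow>\<^sub>L real"
  assumes K: "compact K" "K = {x. \<Phi> x \<le> c + 2} \<inter> X" and \<epsilon>: "0 < \<epsilon>" "\<epsilon> \<le> 1"
    and ne: "\<And>x. x \<in> X \<Longrightarrow> F x \<noteq> {}" and tan: "\<And>x. x \<in> X \<Longrightarrow> F x \<subseteq> tangent_cone X x"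
    and D: "\<And>x. x \<in> X \<Longrightarrow> (\<Phi> has_derivative blinfun_apply (D x)) (at x)"
    and desc: "\<And>x w. x \<in> X \<Longrightarrow> w \<in> F x \<Longrightarrow> blinfun_apply (D x) w \<le> 0"
    and C: "\<And>x w. x \<in> K \<Longrightarrow> w \<in> F x \<Longrightarrow> norm w \<le> C" and C0: "C \<ge> 0"
    and x0: "x0 \<in> X" "\<Phi> x0 \<le> c"
  obtains \<tau> p where "\<tau> 0 = 0" "p 0 = x0" "\<And>n. p n \<in> K" "filterlim \<tau> at_top sequentially"
    "\<And>n. \<tau> n < \<tau> (Suc n)" "\<And>n. \<tau> (Suc n) \<le> \<tau> n + \<epsilon>"
    "\<And>n. norm (p (Suc n) - p n) \<le> (C + 1) * (\<tau> (Suc n) - \<tau> n)"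
    "\<And>n. \<epsilon> * \<tau> n \<le> 1 \<Longrightarrow> \<exists>z\<in>K. norm (z - p n) < \<epsilon> \<and> (\<exists>w\<in>F z. norm (p (Suc n) - p n - (\<tau> (Suc n) - \<tau> n) *\<^sub>R w) \<le> \<epsilon> * (\<tau> (Suc n) - \<tau> n))"
proof -
  have KX: "K \<subseteq> X" using K by auto
  obtain \<eta> where \<eta>: "\<eta> > 0" "\<eta> \<le> \<epsilon>" and step: "\<And>x. x \<in> K \<Longrightarrow> \<exists>h y z w. \<eta> \<le> h \<and> h \<le> \<epsilon> \<and> y \<in> X \<and> z \<in> K \<and> norm (z - x) < \<epsilon> \<and> w \<in> F z \<and>
    norm (y - x - h *\<^sub>R w) \<le> \<epsilon> * h \<and> \<Phi> y - \<Phi> x \<le> \<epsilon> * h"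
    by (rule uniform_descent_step[where F = F and \<Phi> = \<Phi> and D = D, OF K(1) KX \<epsilon>(1)])
      (rule ne tan D desc that; assumption)+
  define inv where "inv s \<longleftrightarrow> (case s of (t, q) \<Rightarrow> q \<in> K \<and> 0 \<le> t \<and> \<Phi> q \<le> c + \<epsilon> * t)" for s :: "real \<times> 'a"
  define rel where "rel s s' \<longleftrightarrow> (case s of (t, q) \<Rightarrow> case s' of (t', q') \<Rightarrow>
      \<eta> \<le> t' - t \<and> t' - t \<le> \<epsilon> \<and> norm (q' - q) \<le> (C + 1) * (t' - t) \<and>
      (\<epsilon> * t \<le> 1 \<longrightarrow> (\<exists>z\<in>K. norm (z - q) < \<epsilon> \<and> (\<exists>w\<in>F z. norm (q' - q - (t' - t) *\<^sub>R w) \<le> \<epsilon> * (t' - t)))))" for s s'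
  have next_state: "\<exists>s'. inv s' \<and> rel s s'" if "inv s" for s
  proof -
    obtain t q where s: "s = (t, q)" by fastforce
    have q: "q \<in> K" "0 \<le> t" "\<Phi> q \<le> c + \<epsilon> * t" using that by (auto simp: inv_def s)
    show ?thesis
    proof (cases "\<epsilon> * t \<le> 1")
      case True
      obtain h y z w where hy: "\<eta> \<le> h" "h \<le> \<epsilon>" "y \<in> X" "z \<in> K" "norm (z - q) < \<epsilon>" "w \<in> F z"
        "norm (y - q - h *\<^sub>R w) \<le> \<epsilon> * h" "\<Phi> y - \<Phi> q \<le> \<epsilon> * h" using step[OF q(1)] by blast
      have h0: "h > 0" using hy(1) \<eta> by simp
      have "\<epsilon> * h \<le> 1 * 1" using hy(2) \<epsilon> h0 by (intro mult_mono) auto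
      then have "y \<in> K" using hy(3,8) q(3) True by (auto simp: K(2))
      have "norm (y - q) \<le> norm (y - q - h *\<^sub>R w) + norm (h *\<^sub>R w)"
        using norm_triangle_ineq[of "y - q - h *\<^sub>R w" "h *\<^sub>R w"] by simp
      also have "\<dots> \<le> 1 * h + h * C"
        using hy(7) C[OF hy(4,6)] h0 \<epsilon> by (intro add_mono) (auto intro: order_trans mult_right_mono)
      finally have "norm (y - q) \<le> (C + 1) * h" by (simp add: algebra_simps)
      moreover have "inv (t + h, y)"
        using \<open>y \<in> K\<close> q h0 hy(8) by (auto simp: inv_def algebra_simps)
      ultimately show ?thesis
        using hy by (intro exI[of _ "(t + h, y)"]) (auto simp: rel_def s)
    next
      case False
      have "0 \<le> \<epsilon> * \<epsilon>" by simp
      then have "\<Phi> q \<le> c + \<epsilon> * (t + \<epsilon>)" using q(3) unfolding distrib_left by linarith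
      then have "inv (t + \<epsilon>, q)" "rel s (t + \<epsilon>, q)"
        using q \<epsilon> \<eta> C0 False by (auto simp: inv_def rel_def s)
      then show ?thesis by blast
    qed
  qed
  have "inv (0, x0)" using x0 by (auto simp: inv_def K(2))
  then have "\<exists>S. \<forall>n. (inv (S n) \<and> (n = 0 \<longrightarrow> S n = (0, x0))) \<and> rel (S n) (S (Suc n))"
    using next_state by (intro dependent_nat_choice) auto
  then obtain S where S: "S 0 = (0, x0)" "\<And>n. inv (S n)" "\<And>n. rel (S n) (S (Suc n))"
    by blast
  have rel': "\<eta> \<le> fst (S (Suc n)) - fst (S n)" "fst (S (Suc n)) - fst (S n) \<le> \<epsilon>"
      "norm (snd (S (Suc n)) - snd (S n)) \<le> (C + 1) * (fst (S (Suc n)) - fst (S n))"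
      "\<epsilon> * fst (S n) \<le> 1 \<Longrightarrow> (\<exists>z\<in>K. norm (z - snd (S n)) < \<epsilon> \<and> (\<exists>w\<in>F z. norm (snd (S (Suc n)) - snd (S n) - (fst (S (Suc n)) - fst (S n)) *\<^sub>R w) \<le> \<epsilon> * (fst (S (Suc n)) - fst (S n))))" for n
    using S(3)[of n] unfolding rel_def case_prod_beta by blast+
  show thesis
  proof
    show "fst (S 0) = 0" "snd (S 0) = x0" by (simp_all add: S(1))
    show "snd (S n) \<in> K" for n using S(2)[of n] by (auto simp: inv_def split: prod.splits)
    have "\<eta> * real n \<le> fst (S n)" for n
    proof (induction n)
      case (Suc n)
      then show ?case using rel'(1)[of n] by (simp add: algebra_simps)
    qed (simp add: S(1))
    moreover have "filterlim (\<lambda>n. \<eta> * real n) at_top sequentially"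
      using \<eta>(1) by (intro filterlim_tendsto_pos_mult_at_top[OF tendsto_const] filterlim_real_sequentially)
    ultimately show "filterlim (\<lambda>n. fst (S n)) at_top sequentially"
      by (rule filterlim_at_top_mono[rotated, OF always_eventually[OF allI]])
    show "fst (S n) < fst (S (Suc n))" for n using rel'(1)[of n] \<eta> by simp
    show "fst (S (Suc n)) \<le> fst (S n) + \<epsilon>" for n using rel'(2)[of n] by simp
    show "norm (snd (S (Suc n)) - snd (S n)) \<le> (C + 1) * (fst (S (Suc n)) - fst (S n))" for n by (rule rel'(3))
  qed (rule rel'(4))
qed

text \<open>Holding the position constant between grid times keeps all values in K; the jumps cost
  the additive \<epsilon> in the Lipschitz estimate. The last clause carries half-space bounds on F
  near z to increments of P. Its condition on \<rho> adds the initial offset, the distance traveled,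
  and the offset \<epsilon> of the points where F is evaluated. The centre z is free so that it can
  later be the limit of \<open>P s\<close>.\<close>

lemma euler_step_function:
  fixes D :: "'a::euclidean_space \<Rightarrow> 'a \<Rightarrow>\<^sub>L real"
  assumes K: "compact K" "K = {x. \<Phi> x \<le> c + 2} \<inter> X" and \<epsilon>: "0 < \<epsilon>" "\<epsilon> \<le> 1"
    and ne: "\<And>x. x \<in> X \<Longrightarrow> F x \<noteq> {}" and tan: "\<And>x. x \<in> X \<Longrightarrow> F x \<subseteq> tangent_cone X x"
    and D: "\<And>x. x \<in> X \<Longrightarrow> (\<Phi> has_derivative blinfun_apply (D x)) (at x)"
    and desc: "\<And>x w. x \<in> X \<Longrightarrow> w \<in> F x \<Longrightarrow> blinfun_apply (D x) w \<le> 0"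
    and C: "\<And>x w. x \<in> K \<Longrightarrow> w \<in> F x \<Longrightarrow> norm w \<le> C" and C0: "C \<ge> 0"
    and x0: "x0 \<in> X" "\<Phi> x0 \<le> c"
  shows "\<exists>P. (\<forall>t\<le>0. P t = x0) \<and> (\<forall>t. P t \<in> K) \<and>
    (\<forall>s t. 0 \<le> s \<longrightarrow> s \<le> t \<longrightarrow> norm (P t - P s) \<le> (C + 1) * (t - s + \<epsilon>)) \<and>
    (\<forall>s t a b z \<rho>. 0 \<le> s \<longrightarrow> s \<le> t \<longrightarrow> \<epsilon> * t \<le> 1 \<longrightarrow>
      (\<forall>y\<in>K. norm (y - z) < \<rho> \<longrightarrow> (\<forall>w\<in>F y. a \<bullet> w \<le> b)) \<longrightarrow>
      norm (P s - z) + (C + 1) * (t - s + \<epsilon>) + \<epsilon> < \<rho> \<longrightarrow>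
      a \<bullet> (P t - P s) \<le> (b + norm a * \<epsilon>) * (t - s) + \<bar>b + norm a * \<epsilon>\<bar> * \<epsilon>)"
proof -
  obtain \<tau> p where \<tau>0: "\<tau> 0 = 0" and p0: "p 0 = x0" and pK: "\<And>n. p n \<in> K" and \<tau>_lim: "filterlim \<tau> at_top sequentially"
    and \<tau>_less: "\<And>n. \<tau> n < \<tau> (Suc n)" and \<tau>_le: "\<And>n. \<tau> (Suc n) \<le> \<tau> n + \<epsilon>"
    and p_lip: "\<And>n. norm (p (Suc n) - p n) \<le> (C + 1) * (\<tau> (Suc n) - \<tau> n)"
    and p_step: "\<And>n. \<epsilon> * \<tau> n \<le> 1 \<Longrightarrow> \<exists>z\<in>K. norm (z - p n) < \<epsilon> \<and>
      (\<exists>w\<in>F z. norm (p (Suc n) - p n - (\<tau> (Suc n) - \<tau> n) *\<^sub>R w) \<le> \<epsilon> * (\<tau> (Suc n) - \<tau> n))"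
    by (rule euler_polygon[where F = F and \<Phi> = \<Phi> and D = D and X = X, OF K \<epsilon> _ _ _ _ _ C0 x0])
      (rule ne tan D desc C that; assumption)+
  have \<tau>_mono: "\<tau> m \<le> \<tau> n" if "m \<le> n" for m n
    using lift_Suc_mono_le[of \<tau>, OF _ that] \<tau>_less less_imp_le by blast
  \<comment> \<open>For \<open>t \<ge> 0\<close> this is the index of the last grid time not after
    t; for negative t it is 0, which extends the step function by x0.\<close>
  define N where "N t = (LEAST n. t < \<tau> (Suc n))" for t
  have ex: "\<exists>n. t < \<tau> (Suc n)" for t
  proof -
    have "\<forall>\<^sub>F n in sequentially. t < \<tau> n" using \<tau>_lim by (simp add: filterlim_at_top_dense)
    then obtain n where "t < \<tau> n" using eventually_happens'[OF sequentially_bot] by blast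
    then show ?thesis using \<tau>_less[of n] by (meson less_trans)
  qed
  have N_upper: "t < \<tau> (Suc (N t))" for t
    unfolding N_def using ex by (rule LeastI_ex)
  have N_lower: "\<tau> (N t) \<le> t" if "0 \<le> t" for t
  proof (cases "N t")
    case (Suc n)
    then have "\<not> t < \<tau> (Suc n)" using not_less_Least[of n "\<lambda>n. t < \<tau> (Suc n)"] by (simp add: N_def)
    then show ?thesis using Suc by simp
  qed (use that \<tau>0 in simp)
  have N0: "N t = 0" if "t \<le> 0" for t
    unfolding N_def by (rule Least_eq_0) (use \<tau>_less[of 0] \<tau>0 that in simp)
  have N_mono: "N s \<le> N t" if "s \<le> t" for s t
    unfolding N_def[of s] by (rule Least_le) (use N_upper[of t] that in simp)
  have grid_lip: "norm (p n - p m) \<le> (C + 1) * (\<tau> n - \<tau> m)" if "m \<le> n" for m n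
    using that
  proof (induction n rule: dec_induct)
    case (step n)
    have "norm (p (Suc n) - p m) \<le> norm (p (Suc n) - p n) + norm (p n - p m)"
      using norm_triangle_ineq[of "p (Suc n) - p n" "p n - p m"] by simp
    then show ?case using step.IH p_lip[of n] by (simp add: algebra_simps)
  qed auto
  \<comment> \<open>Both times are rounded down, so the rounding errors have the same sign and their
    difference costs one \<epsilon> rather than two.\<close>
  have time: "\<tau> (N t) - \<tau> (N s) \<le> t - s + \<epsilon>" "\<bar>(\<tau> (N t) - \<tau> (N s)) - (t - s)\<bar> \<le> \<epsilon>" if "0 \<le> s" "s \<le> t" for s t
    using N_upper[of s] N_upper[of t] N_lower[of s] N_lower[of t] \<tau>_le[of "N s"] \<tau>_le[of "N t"] that by auto
  show ?thesis
  proof (intro exI[of _ "\<lambda>t. p (N t)"] conjI allI impI)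
    show "p (N t) = x0" if "t \<le> 0" for t by (simp add: N0 that p0)
    show "p (N t) \<in> K" for t by (rule pK)
    show "norm (p (N t) - p (N s)) \<le> (C + 1) * (t - s + \<epsilon>)" if "0 \<le> s" "s \<le> t" for s t
      by (rule order_trans[OF grid_lip[OF N_mono[OF that(2)]] mult_left_mono[OF time(1)[OF that]]]) (use C0 in simp)
    fix s t a b z \<rho>
    assume st: "0 \<le> s" "s \<le> t" "\<epsilon> * t \<le> 1" and sep: "\<forall>y\<in>K. norm (y - z) < \<rho> \<longrightarrow> (\<forall>w\<in>F y. a \<bullet> w \<le> b)"
      and \<rho>: "norm (p (N s) - z) + (C + 1) * (t - s + \<epsilon>) + \<epsilon> < \<rho>"
    \<comment> \<open>The bound b per unit time is worsened by the error \<epsilon> with which each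
      step follows its direction. The sign of \<open>b'\<close> is unknown, so rounding the times
      costs its absolute value.\<close>
    define b' where "b' = b + norm a * \<epsilon>"
    have "a \<bullet> (p k - p (N s)) \<le> b' * (\<tau> k - \<tau> (N s))" if "N s \<le> k" "k \<le> N t" for k
      using that
    proof (induction k rule: dec_induct)
      case (step k)
      have \<tau>k: "\<tau> k \<le> \<tau> (N t)" using step by (intro \<tau>_mono) simp
      then have "\<tau> k \<le> t" using N_lower[of t] st by simp
      then have "\<epsilon> * \<tau> k \<le> 1" using order_trans[OF mult_left_mono[of "\<tau> k" t \<epsilon>] st(3)] \<epsilon> by simp
      then obtain y w where y: "y \<in> K" "norm (y - p k) < \<epsilon>" and w: "w \<in> F y"
          "norm (p (Suc k) - p k - (\<tau> (Suc k) - \<tau> k) *\<^sub>R w) \<le> \<epsilon> * (\<tau> (Suc k) - \<tau> k)"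
        using p_step by blast
      have "norm (p k - p (N s)) \<le> (C + 1) * (\<tau> k - \<tau> (N s))" by (rule grid_lip) (use step in simp)
      also have "\<dots> \<le> (C + 1) * (t - s + \<epsilon>)"
        using time(1)[OF st(1,2)] \<tau>k C0 by (intro mult_left_mono) auto
      finally have "norm (p k - p (N s)) \<le> (C + 1) * (t - s + \<epsilon>)" .
      moreover have "norm (y - z) \<le> norm (y - p k) + norm (p k - p (N s)) + norm (p (N s) - z)"
        using norm_triangle_ineq[of "y - p k" "p k - z"] norm_triangle_ineq[of "p k - p (N s)" "p (N s) - z"] by simp
      ultimately have "norm (y - z) < \<rho>" using \<rho> y(2) by simp
      then have aw: "a \<bullet> w \<le> b" using sep y(1) w(1) by blast
      let ?h = "\<tau> (Suc k) - \<tau> k" and ?e = "p (Suc k) - p k - (\<tau> (Suc k) - \<tau> k) *\<^sub>R w"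
      have h: "?h > 0" using \<tau>_less[of k] by simp
      have "a \<bullet> ?e \<le> norm a * norm ?e" by (rule norm_cauchy_schwarz)
      also have "\<dots> \<le> norm a * (\<epsilon> * ?h)" using w(2) by (intro mult_left_mono) auto
      finally have "a \<bullet> ?e \<le> norm a * (\<epsilon> * ?h)" .
      moreover have "?h * (a \<bullet> w) \<le> ?h * b" using aw h by (intro mult_left_mono) auto
      moreover have "a \<bullet> (p (Suc k) - p (N s)) = a \<bullet> (p k - p (N s)) + (?h * (a \<bullet> w) + a \<bullet> ?e)"
        by (simp add: inner_diff_right)
      ultimately show ?case
        using step by (simp add: b'_def algebra_simps)
    qed auto
    from this[of "N t"] have "a \<bullet> (p (N t) - p (N s)) \<le> b' * (\<tau> (N t) - \<tau> (N s))"
      using N_mono st by simp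
    also have "\<dots> = b' * (t - s) + b' * ((\<tau> (N t) - \<tau> (N s)) - (t - s))" by (simp add: algebra_simps)
    also have "\<dots> \<le> b' * (t - s) + \<bar>b'\<bar> * \<epsilon>"
    proof -
      have "b' * ((\<tau> (N t) - \<tau> (N s)) - (t - s)) \<le> \<bar>b'\<bar> * \<bar>(\<tau> (N t) - \<tau> (N s)) - (t - s)\<bar>"
        by (metis abs_ge_self abs_mult)
      also have "\<dots> \<le> \<bar>b'\<bar> * \<epsilon>" using time(2)[OF st(1,2)] by (intro mult_left_mono) auto
      finally show ?thesis by simp
    qed
    finally show "a \<bullet> (p (N t) - p (N s)) \<le> (b + norm a * \<epsilon>) * (t - s) + \<bar>b + norm a * \<epsilon>\<bar> * \<epsilon>"
      by (simp add: b'_def)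
  qed
qed

section \<open>Compactness of the step functions and passage to the limit\<close>

text \<open>Pointwise compactness yields a cluster point, with no single subsequence promised for
  all times. A basic neighborhood restricts finitely many coordinates, so any two prescribed times
  share a subsequence, and two times are all that an estimate on increments involves.\<close>

lemma pointwise_cluster_point:
  fixes P :: "nat \<Rightarrow> 'b \<Rightarrow> 'a::metric_space"
  assumes K: "compact K" and P: "\<And>k t. P k t \<in> K"
  obtains x where "\<And>t. x t \<in> K"
    "\<And>s t. \<exists>\<kappa>. filterlim \<kappa> at_top sequentially \<and> (\<lambda>j. P (\<kappa> j) s) \<longlonglongrightarrow> x s \<and> (\<lambda>j. P (\<kappa> j) t) \<longlonglongrightarrow> x t"
proof -
  have "compactin (product_topology (\<lambda>_. euclidean) UNIV) (Pi\<^sub>E UNIV (\<lambda>_::'b. K))"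
    using K by (subst compactin_PiE) auto
  then have "compact (Pi\<^sub>E UNIV (\<lambda>_::'b. K))" by (simp add: euclidean_product_topology)
  moreover have "filtermap P sequentially \<noteq> bot" by (simp add: filtermap_bot_iff)
  moreover have "eventually (\<lambda>f. f \<in> Pi\<^sub>E UNIV (\<lambda>_. K)) (filtermap P sequentially)"
    by (auto simp: eventually_filtermap P PiE_iff intro!: always_eventually)
  ultimately obtain x where x: "x \<in> Pi\<^sub>E UNIV (\<lambda>_. K)" "inf (nhds x) (filtermap P sequentially) \<noteq> bot"
    unfolding compact_filter by meson
  have near: "\<exists>k\<ge>n. dist (P k s) (x s) < e \<and> dist (P k t) (x t) < e" if "e > 0" for n s t e
  proof (rule ccontr)
    assume no: "\<not> ?thesis"
    have "eventually (\<lambda>f. dist (f s) (x s) < e \<and> dist (f t) (x t) < e) (nhds x)"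
      unfolding eventually_nhds
    proof (intro exI[of _ "{f. \<forall>i\<in>{s,t}. f i \<in> ball (x i) e}"] conjI)
      show "open {f. \<forall>i\<in>{s,t}. f i \<in> ball (x i) e}"
        by (rule product_topology_basis'[where x = "\<lambda>i. i"]) auto
    qed (use that in \<open>auto simp: dist_commute\<close>)
    moreover have "eventually (\<lambda>f. \<not> (dist (f s) (x s) < e \<and> dist (f t) (x t) < e)) (filtermap P sequentially)"
      unfolding eventually_filtermap eventually_sequentially using no by blast
    ultimately have "eventually (\<lambda>_. False) (inf (nhds x) (filtermap P sequentially))"
      unfolding eventually_inf by blast
    then show False using x(2) by (simp add: eventually_False)
  qed
  show thesis
  proof
    show "x t \<in> K" for t using x(1) by auto
    fix s t
    have "\<exists>k\<ge>j. dist (P k s) (x s) < 1 / Suc j \<and> dist (P k t) (x t) < 1 / Suc j" for j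
      by (rule near) simp
    then obtain \<kappa> where \<kappa>: "\<And>j. \<kappa> j \<ge> j" "\<And>j. dist (P (\<kappa> j) s) (x s) < 1 / Suc j" "\<And>j. dist (P (\<kappa> j) t) (x t) < 1 / Suc j"
      by metis
    have "filterlim \<kappa> at_top sequentially"
      by (rule filterlim_at_top_mono[OF filterlim_ident]) (simp add: \<kappa>(1))
    moreover have "(\<lambda>j. P (\<kappa> j) s) \<longlonglongrightarrow> x s" "(\<lambda>j. P (\<kappa> j) t) \<longlonglongrightarrow> x t"
      by (subst tendsto_dist_iff, rule Lim_null_comparison[OF _ LIMSEQ_Suc[OF lim_1_over_n]],
        use \<kappa>(2,3) in \<open>auto intro!: always_eventually less_imp_le simp del: of_nat_Suc\<close>)+
    ultimately show "\<exists>\<kappa>. filterlim \<kappa> at_top sequentially \<and> (\<lambda>j. P (\<kappa> j) s) \<longlonglongrightarrow> x s \<and> (\<lambda>j. P (\<kappa> j) t) \<longlonglongrightarrow> x t"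
      by blast
  qed
qed

lemma lipschitz_abs_continuous_on:
  assumes lip: "\<And>s t. norm (x s - x t) \<le> L * \<bar>s - t\<bar>"
  shows "abs_continuous_on S x"
  unfolding abs_continuous_on_def
proof (intro allI impI)
  fix \<epsilon> :: real assume \<epsilon>: "\<epsilon> > 0"
  have L: "L \<ge> 0" using order_trans[OF norm_ge_zero lip[of 1 0]] by simp
  show "\<exists>\<delta>>0. \<forall>\<D> R. \<D> division_of R \<and> R \<subseteq> S \<and> (\<Sum>K\<in>\<D>. Sup K - Inf K) < \<delta> \<longrightarrow>
      (\<Sum>K\<in>\<D>. norm (x (Sup K) - x (Inf K))) < \<epsilon>"
  proof (intro exI[of _ "\<epsilon> / (L + 1)"] conjI allI impI; (elim conjE)?)
    show "\<epsilon> / (L + 1) > 0" using \<epsilon> L by simp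
    fix \<D> R assume D: "\<D> division_of R" and less: "(\<Sum>K\<in>\<D>. Sup K - Inf K) < \<epsilon> / (L + 1)"
    have le: "Inf K \<le> Sup K" if K: "K \<in> \<D>" for K
    proof -
      obtain u v where "K = cbox u v" "K \<noteq> {}" using division_ofD(3,4)[OF D K] by blast
      then show ?thesis by auto
    qed
    have "(\<Sum>K\<in>\<D>. norm (x (Sup K) - x (Inf K))) \<le> (\<Sum>K\<in>\<D>. L * (Sup K - Inf K))"
    proof (rule sum_mono)
      fix K assume "K \<in> \<D>"
      then show "norm (x (Sup K) - x (Inf K)) \<le> L * (Sup K - Inf K)" using lip[of "Sup K" "Inf K"] le by simp
    qed
    also have "\<dots> = L * (\<Sum>K\<in>\<D>. Sup K - Inf K)" by (simp add: sum_distrib_left)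
    also have "\<dots> \<le> (L + 1) * (\<Sum>K\<in>\<D>. Sup K - Inf K)"
      using le by (intro mult_right_mono sum_nonneg) auto
    also have "\<dots> < \<epsilon>" using less L by (simp add: field_simps)
    finally show "(\<Sum>K\<in>\<D>. norm (x (Sup K) - x (Inf K))) < \<epsilon>" .
  qed
qed

theorem complete_solution_exists:
  fixes D :: "'a::euclidean_space \<Rightarrow> 'a \<Rightarrow>\<^sub>L real"
  assumes ne: "\<And>x. x \<in> X \<Longrightarrow> F x \<noteq> {}" and tan: "\<And>x. x \<in> X \<Longrightarrow> F x \<subseteq> tangent_cone X x"
    and bdd: "\<And>x. x \<in> X \<Longrightarrow> \<exists>C. \<forall>\<^sub>F y in nhds x. y \<in> X \<longrightarrow> (\<forall>w\<in>F y. norm w \<le> C)"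
    and D: "\<And>x. x \<in> X \<Longrightarrow> (\<Phi> has_derivative blinfun_apply (D x)) (at x)"
    and desc: "\<And>x w. x \<in> X \<Longrightarrow> w \<in> F x \<Longrightarrow> blinfun_apply (D x) w \<le> 0"
    and cmp: "\<And>l. compact ({x. \<Phi> x \<le> l} \<inter> X)"
    and x0: "x0 \<in> X"
  obtains x where "complete_solution X F x" "x 0 = x0"
proof -
  define K where "K = {x. \<Phi> x \<le> \<Phi> x0 + 2} \<inter> X"
  have K: "compact K" "K \<subseteq> X" using cmp by (auto simp: K_def)
  obtain C where C0: "C \<ge> 0" and C: "\<And>y w. y \<in> K \<Longrightarrow> w \<in> F y \<Longrightarrow> norm w \<le> C"
    by (rule locally_bounded_field_compact[OF K bdd]) (assumption | rule that; assumption)+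
  define e where "e k = 1 / real (Suc k)" for k
  have e: "0 < e k" "e k \<le> 1" for k by (auto simp: e_def)
  have "\<exists>P. (\<forall>t\<le>0. P t = x0) \<and> (\<forall>t. P t \<in> K) \<and>
    (\<forall>s t. 0 \<le> s \<longrightarrow> s \<le> t \<longrightarrow> norm (P t - P s) \<le> (C + 1) * (t - s + e k)) \<and>
    (\<forall>s t a b z \<rho>. 0 \<le> s \<longrightarrow> s \<le> t \<longrightarrow> e k * t \<le> 1 \<longrightarrow>
      (\<forall>y\<in>K. norm (y - z) < \<rho> \<longrightarrow> (\<forall>w\<in>F y. a \<bullet> w \<le> b)) \<longrightarrow>
      norm (P s - z) + (C + 1) * (t - s + e k) + e k < \<rho> \<longrightarrow>
      a \<bullet> (P t - P s) \<le> (b + norm a * e k) * (t - s) + \<bar>b + norm a * e k\<bar> * e k)" for k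
    by (rule euler_step_function[where X = X and D = D, OF K(1) K_def e ne tan D desc C C0 x0 order_refl])
  then obtain P where P0: "\<And>k t. t \<le> 0 \<Longrightarrow> P k t = x0" and PK: "\<And>k t. P k t \<in> K"
    and P_lip: "\<And>k s t. 0 \<le> s \<Longrightarrow> s \<le> t \<Longrightarrow> norm (P k t - P k s) \<le> (C + 1) * (t - s + e k)"
    and P_sep: "\<And>k s t a b z \<rho>. 0 \<le> s \<Longrightarrow> s \<le> t \<Longrightarrow> e k * t \<le> 1 \<Longrightarrow>
      (\<forall>y\<in>K. norm (y - z) < \<rho> \<longrightarrow> (\<forall>w\<in>F y. a \<bullet> w \<le> b)) \<Longrightarrow>
      norm (P k s - z) + (C + 1) * (t - s + e k) + e k < \<rho> \<Longrightarrow>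
      a \<bullet> (P k t - P k s) \<le> (b + norm a * e k) * (t - s) + \<bar>b + norm a * e k\<bar> * e k"
    by metis
  obtain x where xK: "\<And>t. x t \<in> K" and cluster:
    "\<And>s t. \<exists>\<kappa>. filterlim \<kappa> at_top sequentially \<and> (\<lambda>j. P (\<kappa> j) s) \<longlonglongrightarrow> x s \<and> (\<lambda>j. P (\<kappa> j) t) \<longlonglongrightarrow> x t"
    by (rule pointwise_cluster_point[of K P, OF K(1) PK]) (rule that)
  have e_lim: "(\<lambda>j. e (\<kappa> j)) \<longlonglongrightarrow> 0" if "filterlim \<kappa> at_top sequentially" for \<kappa>
    unfolding e_def by (rule filterlim_compose[OF LIMSEQ_Suc[OF lim_1_over_n] that])
  have x_le0: "x t = x0" if "t \<le> 0" for t
  proof -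
    obtain \<kappa> where "(\<lambda>j. P (\<kappa> j) t) \<longlonglongrightarrow> x t" using cluster by blast
    then have "(\<lambda>j. x0) \<longlonglongrightarrow> x t" using P0[OF that] by simp
    then show ?thesis by (simp add: LIMSEQ_const_iff)
  qed
  have lip0: "norm (x t - x s) \<le> (C + 1) * (t - s)" if "0 \<le> s" "s \<le> t" for s t
  proof -
    obtain \<kappa> where \<kappa>: "filterlim \<kappa> at_top sequentially" "(\<lambda>j. P (\<kappa> j) s) \<longlonglongrightarrow> x s" "(\<lambda>j. P (\<kappa> j) t) \<longlonglongrightarrow> x t"
      using cluster by blast
    have "(\<lambda>j. norm (P (\<kappa> j) t - P (\<kappa> j) s)) \<longlonglongrightarrow> norm (x t - x s)"
      by (intro tendsto_intros \<kappa>)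
    moreover have "(\<lambda>j. (C + 1) * (t - s + e (\<kappa> j))) \<longlonglongrightarrow> (C + 1) * (t - s + 0)"
      by (intro tendsto_intros e_lim \<kappa>)
    ultimately have "norm (x t - x s) \<le> (C + 1) * (t - s + 0)"
      by (rule LIMSEQ_le) (use P_lip[OF that] in blast)
    then show ?thesis by simp
  qed
  have lip1: "norm (x s - x t) \<le> (C + 1) * \<bar>s - t\<bar>" if "0 \<le> s" "0 \<le> t" for s t
    using lip0[of s t] lip0[of t s] that by (cases "s \<le> t") (auto simp: norm_minus_commute)
  \<comment> \<open>The constant extension to negative times makes x Lipschitz on the whole line, as
    the differentiability result requires.\<close>
  have x_max: "x t = x (max 0 t)" for t by (cases "t \<le> 0") (auto simp: x_le0 max_def)
  have lip: "norm (x s - x t) \<le> (C + 1) * \<bar>s - t\<bar>" for s t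
  proof -
    have "norm (x (max 0 s) - x (max 0 t)) \<le> (C + 1) * \<bar>max 0 s - max 0 t\<bar>"
      by (rule lip1) auto
    also have "\<dots> \<le> (C + 1) * \<bar>s - t\<bar>" using C0 by (intro mult_left_mono) auto
    finally show ?thesis using x_max by simp
  qed
  \<comment> \<open>In the limit every error term of the step functions vanishes, and
    \<open>e (\<kappa> j) * t \<le> 1\<close> holds eventually, so no time horizon remains.\<close>
  have sep: "a \<bullet> (x t - x s) \<le> b * (t - s)"
    if st: "0 \<le> s" "s \<le> t" and ab: "\<forall>y\<in>K. norm (y - x s) < \<rho> \<longrightarrow> (\<forall>w\<in>F y. a \<bullet> w \<le> b)"
      and \<rho>: "(C + 1) * (t - s) < \<rho>" for a b s t \<rho>
  proof -
    obtain \<kappa> where \<kappa>: "filterlim \<kappa> at_top sequentially" "(\<lambda>j. P (\<kappa> j) s) \<longlonglongrightarrow> x s" "(\<lambda>j. P (\<kappa> j) t) \<longlonglongrightarrow> x t"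
      using cluster by blast
    note lims = \<kappa>(2,3) e_lim[OF \<kappa>(1)]
    have l1: "(\<lambda>j. a \<bullet> (P (\<kappa> j) t - P (\<kappa> j) s)) \<longlonglongrightarrow> a \<bullet> (x t - x s)"
      by (intro tendsto_intros lims)
    have l2: "(\<lambda>j. (b + norm a * e (\<kappa> j)) * (t - s) + \<bar>b + norm a * e (\<kappa> j)\<bar> * e (\<kappa> j)) \<longlonglongrightarrow>
        (b + norm a * 0) * (t - s) + \<bar>b + norm a * 0\<bar> * 0"
      by (intro tendsto_intros lims)
    have l3: "(\<lambda>j. norm (P (\<kappa> j) s - x s) + (C + 1) * (t - s + e (\<kappa> j)) + e (\<kappa> j)) \<longlonglongrightarrow>
        norm (x s - x s) + (C + 1) * (t - s + 0) + 0"
      by (intro tendsto_intros lims)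
    have l4: "(\<lambda>j. e (\<kappa> j) * t) \<longlonglongrightarrow> 0 * t" by (intro tendsto_intros lims)
    have "\<forall>\<^sub>F j in sequentially. norm (P (\<kappa> j) s - x s) + (C + 1) * (t - s + e (\<kappa> j)) + e (\<kappa> j) < \<rho>"
      by (rule order_tendstoD(2)[OF l3]) (use \<rho> in simp)
    moreover have "\<forall>\<^sub>F j in sequentially. e (\<kappa> j) * t < 1"
      by (rule order_tendstoD(2)[OF l4]) simp
    ultimately have "\<forall>\<^sub>F j in sequentially. a \<bullet> (P (\<kappa> j) t - P (\<kappa> j) s) \<le>
        (b + norm a * e (\<kappa> j)) * (t - s) + \<bar>b + norm a * e (\<kappa> j)\<bar> * e (\<kappa> j)"
      by eventually_elim (rule P_sep[OF st _ ab], auto)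
    then have "a \<bullet> (x t - x s) \<le> (b + norm a * 0) * (t - s) + \<bar>b + norm a * 0\<bar> * 0"
      by (rule tendsto_le[OF sequentially_bot l2 l1])
    then show ?thesis by simp
  qed
  have incl: "v \<in> krasovskii_reg X F (x t)" if t: "0 \<le> t" and v: "(x has_vector_derivative v) (at t)" for t v
  proof (rule ccontr)
    assume notin: "v \<notin> krasovskii_reg X F (x t)"
    have xX: "x t \<in> X" using xK K by blast
    obtain B where B: "\<forall>\<^sub>F y in nhds (x t). y \<in> X \<longrightarrow> (\<forall>w\<in>F y. norm w \<le> B)" using bdd[OF xX] by blast
    obtain a b where ab: "a \<bullet> v > b" "\<forall>\<^sub>F y in nhds (x t). y \<in> X \<longrightarrow> (\<forall>w\<in>F y. a \<bullet> w \<le> b)"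
      by (rule krasovskii_reg_separation[OF xX B notin]) (rule that)
    obtain \<rho> where \<rho>: "\<rho> > 0" "\<And>y. dist y (x t) < \<rho> \<Longrightarrow> y \<in> X \<Longrightarrow> \<forall>w\<in>F y. a \<bullet> w \<le> b"
      using ab(2) unfolding eventually_nhds_metric by blast
    have ab': "\<forall>y\<in>K. norm (y - x t) < \<rho> \<longrightarrow> (\<forall>w\<in>F y. a \<bullet> w \<le> b)"
      using \<rho>(2) K(2) by (auto simp: dist_norm)
    have "((\<lambda>s. a \<bullet> x s) has_real_derivative a \<bullet> v) (at t)"
      using bounded_linear.has_vector_derivative[OF bounded_linear_inner_right v]
      by (simp add: has_real_derivative_iff_has_vector_derivative)
    from has_field_derivative_at_within[OF this, of "{t<..}"]
    have "((\<lambda>s. (a \<bullet> x s - a \<bullet> x t) / (s - t)) \<longlongrightarrow> a \<bullet> v) (at_right t)"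
      by (simp only: has_field_derivative_iff)
    moreover have "\<forall>\<^sub>F s in at_right t. (a \<bullet> x s - a \<bullet> x t) / (s - t) \<le> b"
      unfolding eventually_at_right_field
    \<comment> \<open>At speed at most \<open>C + 1\<close> the curve cannot leave the ball of
      radius \<rho> within this time. The separation bound looks forward only, so a right derivative
      is compared with b.\<close>
    proof (intro exI[of _ "t + \<rho> / (C + 1)"] conjI allI impI)
      show "t < t + \<rho> / (C + 1)" using \<rho>(1) C0 by simp
      fix s assume s: "t < s" "s < t + \<rho> / (C + 1)"
      have "(C + 1) * (s - t) < \<rho>" using s(2) C0 by (simp add: field_simps)
      then have "a \<bullet> (x s - x t) \<le> b * (s - t)" using sep[OF t _ ab'] s(1) by simp
      then show "(a \<bullet> x s - a \<bullet> x t) / (s - t) \<le> b" using s(1) by (simp add: field_simps inner_diff_right)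
    qed
    ultimately have "a \<bullet> v \<le> b" by (rule tendsto_upperbound) simp
    then show False using ab(1) by simp
  qed
  have sol: "complete_solution X F x"
    unfolding krasovskii_solution_def
  proof (intro conjI allI impI)
    show "x t \<in> X" for t using xK K by blast
    show "abs_continuous_on {0..b} x" for b by (rule lipschitz_abs_continuous_on[OF lip])
    show "AE t in lebesgue. 0 \<le> t \<and> ereal t < \<infinity> \<longrightarrow> (\<exists>v\<in>krasovskii_reg X F (x t). (x has_vector_derivative v) (at t))"
      using lipschitz_has_vector_derivative_ae[OF lip] by eventually_elim (use incl in blast)
  qed simp
  show thesis by (rule that[OF sol x_le0[OF order_refl]])
qed

lemma abs_continuous_on_imp_continuous_on:
  assumes "abs_continuous_on {a..b} x"
  shows "continuous_on {a..b} x"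
  unfolding continuous_on_iff
proof (intro ballI allI impI)
  fix t \<epsilon> :: real assume t: "t \<in> {a..b}" and \<epsilon>: "\<epsilon> > 0"
  obtain \<delta> where \<delta>: "\<delta> > 0" "\<And>\<D> R. \<D> division_of R \<Longrightarrow> R \<subseteq> {a..b} \<Longrightarrow> (\<Sum>K\<in>\<D>. Sup K - Inf K) < \<delta> \<Longrightarrow>
      (\<Sum>K\<in>\<D>. norm (x (Sup K) - x (Inf K))) < \<epsilon>"
    using assms \<epsilon> unfolding abs_continuous_on_def by meson
  have *: "norm (x v - x u) < \<epsilon>" if "u \<in> {a..b}" "v \<in> {a..b}" "u \<le> v" "v - u < \<delta>" for u v
    using \<delta>(2)[of "{{u..v}}" "{u..v}"] that division_of_self[of u v] by simp
  show "\<exists>d>0. \<forall>s\<in>{a..b}. dist s t < d \<longrightarrow> dist (x s) (x t) < \<epsilon>"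
  proof (intro exI[of _ \<delta>] conjI ballI impI)
    fix s assume "s \<in> {a..b}" "dist s t < \<delta>"
    then show "dist (x s) (x t) < \<epsilon>"
      using *[of s t] *[of t s] t by (cases "s \<le> t") (auto simp: dist_norm norm_minus_commute)
  qed (rule \<delta>(1))
qed

subsection \<open>Stability and strict minimizers\<close>

lemma abs_continuous_on_subset: "abs_continuous_on S x \<Longrightarrow> T \<subseteq> S \<Longrightarrow> abs_continuous_on T x"
  unfolding abs_continuous_on_def by (meson order_trans)

text \<open>The mean value bound needs a convex domain, hence a ball around z. The explicit constant
  is bounded along a compact piece of a curve, which yields one M for all times there.\<close>

lemma C1_locally_lipschitz:
  fixes D :: "'a::euclidean_space \<Rightarrow> 'a \<Rightarrow>\<^sub>L real"
  assumes U: "open U" and D: "\<And>y. y \<in> U \<Longrightarrow> (\<Phi> has_derivative blinfun_apply (D y)) (at y)"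
    and cont: "continuous_on U D" and z: "z \<in> U"
  obtains \<rho> where "\<rho> > 0" "\<And>p q. p \<in> ball z \<rho> \<Longrightarrow> q \<in> ball z \<rho> \<Longrightarrow> \<bar>\<Phi> p - \<Phi> q\<bar> \<le> (norm (D z) + 1) * norm (p - q)"
proof -
  have "isCont (\<lambda>y. norm (D y)) z"
    using cont U z by (intro continuous_intros) (simp add: continuous_on_eq_continuous_at)
  then have "((\<lambda>y. norm (D y)) \<longlongrightarrow> norm (D z)) (nhds z)"
    by (simp add: isCont_def tendsto_nhds_iff continuous_at)
  then have "\<forall>\<^sub>F y in nhds z. norm (D y) < norm (D z) + 1" by (rule order_tendstoD(2)) simp
  moreover have "\<forall>\<^sub>F y in nhds z. y \<in> U" using U z by (rule eventually_nhds_in_open)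
  ultimately have "\<forall>\<^sub>F y in nhds z. y \<in> U \<and> norm (D y) < norm (D z) + 1" by eventually_elim simp
  then obtain \<rho> where \<rho>: "\<rho> > 0" "\<And>y. dist y z < \<rho> \<Longrightarrow> y \<in> U \<and> norm (D y) < norm (D z) + 1"
    unfolding eventually_nhds_metric by blast
  show thesis
  proof
    fix p q assume pq: "p \<in> ball z \<rho>" "q \<in> ball z \<rho>"
    have "norm (\<Phi> p - \<Phi> q) \<le> (norm (D z) + 1) * norm (p - q)"
    proof (rule differentiable_bound[OF convex_ball _ _ pq])
      fix y assume "y \<in> ball z \<rho>"
      then have y: "y \<in> U" "norm (D y) < norm (D z) + 1" using \<rho>(2)[of y] by (auto simp: dist_commute)
      show "(\<Phi> has_derivative blinfun_apply (D y)) (at y within ball z \<rho>)"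
        using D[OF y(1)] by (rule has_derivative_at_withinI)
      show "onorm (blinfun_apply (D y)) \<le> norm (D z) + 1" using y(2) by (simp add: norm_blinfun.rep_eq)
    qed
    then show "\<bar>\<Phi> p - \<Phi> q\<bar> \<le> (norm (D z) + 1) * norm (p - q)" by simp
  qed (rule \<rho>(1))
qed

lemma derivative_along_curve:
  assumes "(\<Phi> has_derivative blinfun_apply D) (at (x t))" "(x has_vector_derivative v) (at t)"
  shows "((\<lambda>s. \<Phi> (x s)) has_real_derivative blinfun_apply D v) (at t)"
  using diff_chain_at[OF assms(2)[unfolded has_vector_derivative_def] assms(1)]
  by (simp add: has_field_derivative_def o_def blinfun.scaleR_right mult_commute_abs)

lemma complete_solution_nonincreasing:
  fixes D :: "'a::euclidean_space \<Rightarrow> 'a \<Rightarrow>\<^sub>L real"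
  assumes U: "open U" "X \<subseteq> U" and D: "\<And>y. y \<in> U \<Longrightarrow> (\<Phi> has_derivative blinfun_apply (D y)) (at y)"
    and cont: "continuous_on U D"
    and desc: "\<And>y v. y \<in> X \<Longrightarrow> v \<in> krasovskii_reg X F y \<Longrightarrow> blinfun_apply (D y) v \<le> 0"
    and x: "complete_solution X F x" and ab: "0 \<le> a" "a \<le> b"
  shows "\<Phi> (x b) \<le> \<Phi> (x a)"
proof -
  have xX: "x t \<in> X" if "0 \<le> t" for t using x that by (simp add: krasovskii_solution_def)
  have "abs_continuous_on {0..b} x" using x ab by (simp add: krasovskii_solution_def)
  then have ac: "abs_continuous_on {a..b} x" by (rule abs_continuous_on_subset) (use ab in auto)
  then have x_cont: "continuous_on {a..b} x" by (rule abs_continuous_on_imp_continuous_on)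
  have "continuous_on {a..b} (\<lambda>t. norm (D (x t)))"
    using xX U(2) ab by (intro continuous_on_norm continuous_on_compose2[OF cont x_cont]) auto
  then obtain t0 where t0: "\<And>t. t \<in> {a..b} \<Longrightarrow> norm (D (x t)) \<le> norm (D (x t0))"
    using continuous_attains_sup[OF compact_Icc, of a b "\<lambda>t. norm (D (x t))"] ab(2)
    by (metis atLeastatMost_empty_iff)
  define M where "M = norm (D (x t0)) + 1"
  show ?thesis
  proof (rule abs_continuous_on_nonincreasing[OF ac ab(2), where M = M])
    show "M > 0" by (simp add: M_def add_nonneg_pos)
    show "\<exists>\<delta>>0. \<forall>u\<in>{a..b}. \<forall>v\<in>{a..b}. \<bar>u - t\<bar> < \<delta> \<longrightarrow> \<bar>v - t\<bar> < \<delta> \<longrightarrow>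
        \<bar>\<Phi> (x v) - \<Phi> (x u)\<bar> \<le> M * norm (x v - x u)" if t: "t \<in> {a..b}" for t
    proof -
      have "x t \<in> U" using xX U(2) t ab by auto
      then obtain \<rho> where \<rho>: "\<rho> > 0" "\<And>p q. p \<in> ball (x t) \<rho> \<Longrightarrow> q \<in> ball (x t) \<rho> \<Longrightarrow>
          \<bar>\<Phi> p - \<Phi> q\<bar> \<le> (norm (D (x t)) + 1) * norm (p - q)"
        using C1_locally_lipschitz[OF U(1) D cont] by metis
      obtain \<delta> where \<delta>: "\<delta> > 0" "\<And>s. s \<in> {a..b} \<Longrightarrow> dist s t < \<delta> \<Longrightarrow> dist (x s) (x t) < \<rho>"
        using x_cont t \<rho>(1) unfolding continuous_on_iff by meson
      have "\<bar>\<Phi> (x v) - \<Phi> (x u)\<bar> \<le> M * norm (x v - x u)"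
        if "u \<in> {a..b}" "v \<in> {a..b}" "\<bar>u - t\<bar> < \<delta>" "\<bar>v - t\<bar> < \<delta>" for u v
      proof -
        have "\<bar>\<Phi> (x v) - \<Phi> (x u)\<bar> \<le> (norm (D (x t)) + 1) * norm (x v - x u)"
          using \<delta>(2)[of u] \<delta>(2)[of v] that by (intro \<rho>(2)) (auto simp: dist_real_def dist_commute)
        also have "\<dots> \<le> M * norm (x v - x u)"
          using t0[OF t] by (intro mult_right_mono) (auto simp: M_def)
        finally show ?thesis .
      qed
      then show ?thesis using \<delta>(1) by blast
    qed
    have "AE t in lebesgue. 0 \<le> t \<and> ereal t < \<infinity> \<longrightarrow> (\<exists>v\<in>krasovskii_reg X F (x t). (x has_vector_derivative v) (at t))"
      using x by (simp add: krasovskii_solution_def)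
    then show "AE t in lebesgue. a < t \<and> t < b \<longrightarrow> (\<exists>d\<le>0. ((\<lambda>t. \<Phi> (x t)) has_real_derivative d) (at t))"
    proof eventually_elim
      case (elim t)
      show ?case
      proof
        assume t: "a < t \<and> t < b"
        then have t0: "0 \<le> t" using ab by simp
        with elim obtain v where v: "v \<in> krasovskii_reg X F (x t)" "(x has_vector_derivative v) (at t)" by auto
        have "x t \<in> U" using xX[OF t0] U(2) by blast
        from derivative_along_curve[where x = x and v = v, OF D[OF this] v(2)] desc[OF xX[OF t0] v(1)]
        show "\<exists>d\<le>0. ((\<lambda>t. \<Phi> (x t)) has_real_derivative d) (at t)" by blast
      qed
    qed
  qed
qed

lemma complete_solution_continuous_on:
  "complete_solution X F x \<Longrightarrow> 0 \<le> b \<Longrightarrow> continuous_on {0..b} x"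
  unfolding krasovskii_solution_def by (simp add: abs_continuous_on_imp_continuous_on)

lemma rel_neighborhood_infdist_less:
  "A \<noteq> {} \<Longrightarrow> A \<subseteq> X \<Longrightarrow> \<delta> > 0 \<Longrightarrow> rel_neighborhood X A {y \<in> X. infdist y A < \<delta>}"
  unfolding rel_neighborhood_def
  by (intro conjI exI[of _ "X \<inter> {y. infdist y A < \<delta>}"] openin_open_Int open_Collect_less continuous_intros)
    auto

lemma rel_neighborhood_contains_tube:
  assumes V: "rel_neighborhood X A V" and A: "compact A" "A \<noteq> {}"
  obtains e where "e > 0" "{y \<in> X. infdist y A \<le> e} \<subseteq> V"
proof -
  obtain G where G: "open G" "A \<subseteq> X \<inter> G" "X \<inter> G \<subseteq> V"
    using V unfolding rel_neighborhood_def openin_open by blast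
  then obtain e where "e > 0" "{y. infdist y A \<le> e} \<subseteq> G"
    using compact_in_open_separated[OF A(2,1) G(1)] by blast
  then show thesis using G(3) by (intro that[of e]) auto
qed

text \<open>By convention \<open>infdist\<close> to the empty set is 0, so tubes around it say
  nothing and the empty case is settled separately in both implications.\<close>

lemma strict_minimizer_set_empty: "strict_minimizer_set X \<Phi> r {}"
  unfolding strict_minimizer_set_def rel_neighborhood_def by (auto intro!: exI[of _ "{}"])

lemma stable_set_empty: "stable_set X F {}"
  unfolding stable_set_def rel_neighborhood_def by (auto intro!: exI[of _ "{}"])

lemma strict_minimizer_imp_stable:
  fixes A :: "'a::euclidean_space set"
  assumes cmp: "\<And>l. compact ({x. \<Phi> x \<le> l} \<inter> X)" and U: "open U" "X \<subseteq> U" and \<Phi>: "continuous_on U \<Phi>"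
    and A: "A \<subseteq> {x\<in>X. \<Phi> x = r}" "compact A"
    and mono: "\<And>x t. complete_solution X F x \<Longrightarrow> 0 \<le> t \<Longrightarrow> \<Phi> (x t) \<le> \<Phi> (x 0)"
    and strict: "strict_minimizer_set X \<Phi> r A"
  shows "stable_set X F A"
proof (cases "A = {}")
  case True
  then show ?thesis by (simp add: stable_set_empty)
next
  case False
  show ?thesis
    unfolding stable_set_def
  proof (intro allI impI)
    fix V assume V: "rel_neighborhood X A V"
    obtain N where N: "rel_neighborhood X A N" "\<And>y. y \<in> N - A \<Longrightarrow> \<Phi> y > r"
      using strict unfolding strict_minimizer_set_def by blast
    obtain e1 where e1: "e1 > 0" "{y \<in> X. infdist y A \<le> e1} \<subseteq> V"
      by (rule rel_neighborhood_contains_tube[OF V A(2) False])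
    obtain e2 where e2: "e2 > 0" "{y \<in> X. infdist y A \<le> e2} \<subseteq> N"
      by (rule rel_neighborhood_contains_tube[OF N(1) A(2) False])
    define e where "e = min e1 e2"
    have e: "e > 0" "{y \<in> X. infdist y A \<le> e} \<subseteq> V" "{y \<in> X. infdist y A \<le> e} \<subseteq> N"
      using e1 e2 by (auto simp: e_def)
    \<comment> \<open>The sublevel makes this shell around A compact. Discarding points with \<Phi>
      above r + 1 is harmless, since the barrier \<open>m \<le> r + 1\<close> already excludes them
      for a trajectory starting in \<open>W\<close>.\<close>
    define S where "S = {y. infdist y A = e} \<inter> ({x. \<Phi> x \<le> r + 1} \<inter> X)"
    have "compact S" unfolding S_def
      by (intro closed_Int_compact cmp closed_Collect_eq continuous_intros)
    have S_gt: "\<Phi> y > r" if "y \<in> S" for y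
    proof -
      have "y \<notin> A" using that e(1) by (auto simp: S_def)
      then show ?thesis using N(2)[of y] that e(3) by (auto simp: S_def)
    qed
    obtain m where m: "r < m" "m \<le> r + 1" "\<And>y. y \<in> S \<Longrightarrow> m \<le> \<Phi> y"
    proof (cases "S = {}")
      case True
      then show ?thesis by (intro that[of "r + 1"]) auto
    next
      case False
      have "continuous_on S \<Phi>" using U(2) by (intro continuous_on_subset[OF \<Phi>]) (auto simp: S_def)
      then obtain y0 where y0: "y0 \<in> S" "\<And>y. y \<in> S \<Longrightarrow> \<Phi> y0 \<le> \<Phi> y"
        using continuous_attains_inf[OF \<open>compact S\<close> False] by blast
      then show ?thesis using S_gt[OF y0(1)] by (intro that[of "\<Phi> y0"]) (auto simp: S_def)
    qed
    define W where "W = {y \<in> X. infdist y A < e \<and> \<Phi> y < m}"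
    have "rel_neighborhood X A W"
      unfolding rel_neighborhood_def
    proof (intro conjI exI[of _ W])
      have o1: "open (U \<inter> \<Phi> -` {..<m})" using \<Phi> U(1) by (intro continuous_open_preimage) auto
      have o2: "open {y. infdist y A < e}" by (intro open_Collect_less continuous_intros)
      have "openin (top_of_set X) (X \<inter> ({y. infdist y A < e} \<inter> (U \<inter> \<Phi> -` {..<m})))"
        by (rule openin_open_Int[OF open_Int[OF o2 o1]])
      moreover have "X \<inter> ({y. infdist y A < e} \<inter> (U \<inter> \<Phi> -` {..<m})) = W" using U(2) by (auto simp: W_def)
      ultimately show "openin (top_of_set X) W" by simp
      show "A \<subseteq> W" using A(1) e(1) m(1) by (auto simp: W_def)
    qed (auto simp: W_def)
    moreover have "x t \<in> V" if x: "complete_solution X F x" and x0: "x 0 \<in> W" and t: "0 \<le> t" for x t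
    proof -
      have xX: "x s \<in> X" if "0 \<le> s" for s using x that by (simp add: krasovskii_solution_def)
      have "infdist (x t) A \<le> e"
      \<comment> \<open>To get farther than e from A, the trajectory must have distance exactly e at
        some time, where \<Phi> would be at least m although it started below m and never
        increases.\<close>
      proof (rule ccontr)
        assume gt: "\<not> ?thesis"
        have "continuous_on {0..t} (\<lambda>s. infdist (x s) A)"
          by (intro continuous_intros complete_solution_continuous_on[OF x t])
        then obtain s where s: "0 \<le> s" "s \<le> t" "infdist (x s) A = e"
          using IVT'[of "\<lambda>s. infdist (x s) A" 0 e t] x0 gt t by (auto simp: W_def)
        have less: "\<Phi> (x s) < m" using mono[OF x s(1)] x0 by (simp add: W_def)
        then have "x s \<in> S" using s m(2) xX by (auto simp: S_def)
        then show False using m(3) less by fastforce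
      qed
      then show ?thesis using e(2) xX[OF t] by blast
    qed
    ultimately show "\<exists>W. rel_neighborhood X A W \<and> (\<forall>x. complete_solution X F x \<and> x 0 \<in> W \<longrightarrow> (\<forall>t\<ge>0. x t \<in> V))"
      by blast
  qed
qed

text \<open>The inclusion holds almost everywhere and an interval of positive length is not null, so
  some instant in it qualifies; which one cannot be prescribed.\<close>

lemma complete_solution_derivative_in_interval:
  assumes x: "complete_solution X F x" and b: "0 < b"
  obtains t v where "0 < t" "t < b" "v \<in> krasovskii_reg X F (x t)" "(x has_vector_derivative v) (at t)"
proof (rule ccontr)
  assume no: "\<not> thesis"
  have "AE t in lebesgue. 0 \<le> t \<and> ereal t < \<infinity> \<longrightarrow> (\<exists>v\<in>krasovskii_reg X F (x t). (x has_vector_derivative v) (at t))"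
    using x by (simp add: krasovskii_solution_def)
  then have "AE t in lebesgue. t \<notin> {0<..<b}"
    by eventually_elim (use no that in auto)
  then have "{0<..<b} \<in> null_sets lebesgue" by (subst AE_iff_null_sets) auto
  then show False using b by (auto simp: null_sets_def)
qed

lemma asymptotically_stable_imp_strict_minimizer:
  fixes D :: "'a::euclidean_space \<Rightarrow> 'a \<Rightarrow>\<^sub>L real"
  assumes U: "open U" "X \<subseteq> U" and D: "\<And>y. y \<in> U \<Longrightarrow> (\<Phi> has_derivative blinfun_apply (D y)) (at y)"
    and A: "A \<subseteq> {x\<in>X. \<Phi> x = r}" "compact A"
    and ex: "\<And>y. y \<in> X \<Longrightarrow> \<exists>x. complete_solution X F x \<and> x 0 = y"
    and mono: "\<And>x s t. complete_solution X F x \<Longrightarrow> 0 \<le> s \<Longrightarrow> s \<le> t \<Longrightarrow> \<Phi> (x t) \<le> \<Phi> (x s)"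
    and crit: "\<And>y v. y \<in> X \<Longrightarrow> v \<in> krasovskii_reg X F y \<Longrightarrow> blinfun_apply (D y) v = 0 \<Longrightarrow> weak_K_equilibrium X F y"
    and las: "locally_asymptotically_stable X F A"
  shows "strict_minimizer_set X \<Phi> r A"
proof (cases "A = {}")
  case True
  then show ?thesis by (simp add: strict_minimizer_set_empty)
next
  case False
  have "closed A" using A(2) by (rule compact_imp_closed)
  obtain \<delta> where \<delta>: "\<delta> > 0" "\<And>x. complete_solution X F x \<Longrightarrow> infdist (x 0) A \<le> \<delta> \<Longrightarrow>
      ((\<lambda>t. infdist (x t) A) \<longlongrightarrow> 0) at_top"
    using las unfolding locally_asymptotically_stable_def by blast
  have isolated: "y \<in> A" if "weak_K_equilibrium X F y" "infdist y A \<le> \<delta>" for y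
  proof -
    have "((\<lambda>t::real. infdist y A) \<longlongrightarrow> 0) at_top"
      using \<delta>(2)[of "\<lambda>_. y"] that by (simp add: weak_K_equilibrium_def)
    then have "infdist y A = 0" by (simp add: tendsto_const_iff)
    then show ?thesis using \<open>closed A\<close> False in_closed_iff_infdist_zero by blast
  qed
  have \<Phi>: "continuous_on U \<Phi>"
    using D by (intro continuous_at_imp_continuous_on) (auto intro: has_derivative_continuous)
  show ?thesis
    unfolding strict_minimizer_set_def
  proof (intro exI[of _ "{y \<in> X. infdist y A < \<delta>}"] conjI ballI)
    show "rel_neighborhood X A {y \<in> X. infdist y A < \<delta>}"
      using A \<delta>(1) False by (intro rel_neighborhood_infdist_less) auto
    fix y assume y: "y \<in> {y \<in> X. infdist y A < \<delta>} - A"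
    show "\<Phi> y > r"
    proof (rule ccontr)
      assume "\<not> \<Phi> y > r"
      then have \<Phi>y: "\<Phi> y \<le> r" by simp
      obtain x where x: "complete_solution X F x" "x 0 = y" using ex y by blast
      have xX: "x t \<in> X" if "0 \<le> t" for t using x that by (simp add: krasovskii_solution_def)
      have lim: "((\<lambda>t. infdist (x t) A) \<longlongrightarrow> 0) at_top" using \<delta>(2)[OF x(1)] x(2) y by simp
      \<comment> \<open>If \<Phi> fell below r at time s, the points with larger values of \<Phi>
        would contain a tube around A. The trajectory eventually enters that tube, which contradicts
        monotonicity. No limit point of the trajectory has to be selected.\<close>
      have "\<Phi> (x s) \<ge> r" if s: "0 \<le> s" for s
      proof (rule ccontr)
        assume "\<not> \<Phi> (x s) \<ge> r"
        then have lt: "\<Phi> (x s) < r" by simp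
        have "open (U \<inter> \<Phi> -` {\<Phi> (x s)<..})" using \<Phi> U(1) by (intro continuous_open_preimage) auto
        moreover have "A \<subseteq> U \<inter> \<Phi> -` {\<Phi> (x s)<..}" using A(1) U(2) lt by auto
        ultimately obtain e where e: "e > 0" "{y. infdist y A \<le> e} \<subseteq> U \<inter> \<Phi> -` {\<Phi> (x s)<..}"
          using compact_in_open_separated[OF False A(2)] by metis
        have "\<forall>\<^sub>F t in at_top. infdist (x t) A < e" using lim e(1) by (rule order_tendstoD(2))
        then have "\<forall>\<^sub>F t in at_top. s \<le> t \<and> infdist (x t) A < e"
          using eventually_ge_at_top[of s] by eventually_elim simp
        then obtain t where "s \<le> t" "infdist (x t) A < e"
          using eventually_happens'[OF trivial_limit_at_top_linorder[where 'a = real]] by blast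
        then have "x t \<in> {y. infdist y A \<le> e}" by simp
        from subsetD[OF e(2) this] have "\<Phi> (x s) < \<Phi> (x t)" by simp
        then show False using mono[OF x(1) s \<open>s \<le> t\<close>] by simp
      qed
      then have const: "\<Phi> (x s) = r" if "0 \<le> s" for s
        using that mono[OF x(1) order_refl that] x(2) \<Phi>y by (simp add: order_antisym)
      have "infdist y A > 0"
        using y \<open>closed A\<close> False in_closed_iff_infdist_zero infdist_nonneg[of y A] by force
      moreover have "continuous_on {0..1} (\<lambda>s. infdist (x s) A)"
        by (intro continuous_intros complete_solution_continuous_on[OF x(1)]) simp
      \<comment> \<open>The two entries of the minimum keep the distance to A positive and below
        \<delta> for a short time after the start.\<close>
      ultimately obtain b where b: "0 < b" "\<And>t. t \<in> {0..1} \<Longrightarrow> dist t 0 < b \<Longrightarrow>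
          dist (infdist (x t) A) (infdist y A) < min (infdist y A) (\<delta> - infdist y A)"
        using y x(2) unfolding continuous_on_iff
        by (metis (no_types, lifting) DiffD1 atLeastAtMost_iff diff_gt_0_iff_gt mem_Collect_eq min_less_iff_conj order_refl zero_le_one)
      have "0 < min b 1" using b(1) by simp
      then obtain t v where t: "0 < t" "t < min b 1" and v: "v \<in> krasovskii_reg X F (x t)" "(x has_vector_derivative v) (at t)"
        by (rule complete_solution_derivative_in_interval[OF x(1)])
      have "dist (infdist (x t) A) (infdist y A) < min (infdist y A) (\<delta> - infdist y A)"
        using t by (intro b(2)) auto
      then have near: "0 < infdist (x t) A" "infdist (x t) A \<le> \<delta>" by (auto simp: dist_real_def)
      have xt: "x t \<in> X" "x t \<in> U" using xX[of t] t U(2) by auto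
      have "((\<lambda>s. \<Phi> (x s)) has_real_derivative D (x t) v) (at t)"
        by (rule derivative_along_curve[where x = x and v = v, OF D[OF xt(2)] v(2)])
      \<comment> \<open>Radius t keeps the neighborhood of t inside positive times, where \<Phi> is
        constant along the curve.\<close>
      then have "D (x t) v = 0"
        by (rule DERIV_local_const[OF _ t(1)]) (use const t in auto)
      then have "x t \<in> A" using isolated[OF crit[OF xt(1) v(1)]] near(2) by blast
      then show False using near(1) by simp
    qed
  qed
qed

theorem theorem8p7:
  fixes X Xhat :: "(real ^ 'n) set"
    and g :: "real ^ 'n \<Rightarrow> real ^ 'n \<Rightarrow> real ^ 'n \<Rightarrow> real"
    and \<Phi> :: "real ^ 'n \<Rightarrow> real"
    and r :: real
  defines "F \<equiv> projected_field X g (\<lambda>x. - metric_grad g \<Phi> x)"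
  assumes "closed X"
    and "metric_on X g" and "locally_weakly_bounded X g"
    and "C1_near \<Phi> X"
    and "locally_bounded_on X (metric_grad g \<Phi>)"
    and "\<And>l. compact ({x. \<Phi> x \<le> l} \<inter> X)"
    and "Xhat \<subseteq> {x\<in>X. \<Phi> x = r}"
    and "compact Xhat" and "connected Xhat"
    and "\<And>p. p \<in> Xhat \<Longrightarrow> weak_K_equilibrium X F p"
  shows "(locally_asymptotically_stable X F Xhat \<longrightarrow> strict_minimizer_set X \<Phi> r Xhat) \<and>
         (strict_minimizer_set X \<Phi> r Xhat \<longrightarrow> stable_set X F Xhat)"
proof -
  obtain U and D :: "real ^ 'n \<Rightarrow> (real ^ 'n) \<Rightarrow>\<^sub>L real" where U: "open U" "X \<subseteq> U"
    and D: "\<And>y. y \<in> U \<Longrightarrow> (\<Phi> has_derivative blinfun_apply (D y)) (at y)" and D_cont: "continuous_on U D"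
    using \<open>C1_near \<Phi> X\<close> unfolding C1_near_def by blast
  have DX: "\<And>y. y \<in> X \<Longrightarrow> (\<Phi> has_derivative blinfun_apply (D y)) (at y)" using D U(2) by blast
  have B: "is_inner_product (g y)" if "y \<in> X" for y using \<open>metric_on X g\<close> that by (simp add: metric_on_def)
  have ne: "F y \<noteq> {}" if "y \<in> X" for y
    unfolding F_def by (rule projected_field_nonempty[where g = g and x = y, OF B[OF that] that])
  have K: "\<exists>C>0. \<forall>v\<in>krasovskii_reg X F y. norm (D y) * (norm v)\<^sup>2 \<le> C * - D y v" if y: "y \<in> X" for y
  proof -
    obtain C where "C > 0"
      "\<And>v. v \<in> krasovskii_reg X (grad_field X g \<Phi>) y \<Longrightarrow> norm (D y) * (norm v)\<^sup>2 \<le> C * - D y v"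
      by (rule krasovskii_projected_gradient[OF assms(3,4,6) DX continuous_on_subset[OF D_cont U(2)] y]) (assumption | rule that; assumption)+
    then show ?thesis unfolding F_def by blast
  qed
  have desc: "D y v \<le> 0" if y: "y \<in> X" and v: "v \<in> krasovskii_reg X F y" for y v
  proof -
    obtain C where "C > 0" "norm (D y) * (norm v)\<^sup>2 \<le> C * - D y v" using K[OF y] v by blast
    then have "0 \<le> C * - D y v" by (meson mult_nonneg_nonneg norm_ge_zero order_trans zero_le_power2)
    then show ?thesis using \<open>C > 0\<close> by (simp add: mult_le_0_iff)
  qed
  \<comment> \<open>If \<open>D y\<close> is nonzero, the decrease inequality forces v = 0, so v
    itself witnesses the equilibrium. If \<open>D y\<close> vanishes, v is uninformative, but any w
    in \<open>F y\<close> satisfies \<open>g y w w = - D y w = 0\<close>, so 0 already lies in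
    \<open>F y\<close>.\<close>
  have crit: "weak_K_equilibrium X F y" if y: "y \<in> X" and v: "v \<in> krasovskii_reg X F y" "D y v = 0" for y v
  proof (cases "D y = 0")
    case True
    obtain w where w: "w \<in> F y" using ne[OF y] by blast
    then have "g y w w = 0"
      using projected_gradient_self_inner[where g = g and y = y, OF B[OF y] DX[OF y]] True by (simp add: F_def)
    then have "w = 0" using B[OF y] unfolding is_inner_product_def by (metis less_irrefl)
    then show ?thesis using w subset_krasovskii_reg[OF y, of F] y by (auto simp: weak_K_equilibrium_iff)
  next
    case False
    obtain C where "norm (D y) * (norm v)\<^sup>2 \<le> C * - D y v" using K[OF y] v(1) by blast
    then have "v = 0" using v(2) False by (simp add: mult_le_0_iff)
    then show ?thesis using v(1) y by (simp add: weak_K_equilibrium_iff)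
  qed
  have mono: "\<Phi> (x t) \<le> \<Phi> (x s)" if "complete_solution X F x" "0 \<le> s" "s \<le> t" for x s t
    by (rule complete_solution_nonincreasing[OF U D D_cont desc that])
  have ex: "\<exists>x. complete_solution X F x \<and> x 0 = y" if y: "y \<in> X" for y
  proof -
    have bdd: "\<exists>C. \<forall>\<^sub>F y in nhds z. y \<in> X \<longrightarrow> (\<forall>w\<in>F y. norm w \<le> C)" if z: "z \<in> X" for z
    proof -
      obtain C where "C > 0" and C: "\<forall>\<^sub>F y in nhds z. y \<in> X \<longrightarrow> (\<forall>w\<in>grad_field X g \<Phi> y.
          norm w \<le> C \<and> norm (D y) * (norm w)\<^sup>2 \<le> C * - D y w)"
        by (rule projected_gradient_locally_bounded[OF assms(3,4,6) DX z])
      show ?thesis unfolding F_def by (rule exI[of _ C], rule eventually_mono[OF C]) blast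
    qed
    have tan: "F z \<subseteq> tangent_cone X z" for z unfolding F_def by (rule projected_field_subset)
    have desc': "D z w \<le> 0" if "z \<in> X" "w \<in> F z" for z w
      using desc[OF that(1)] subset_krasovskii_reg[OF that(1), of F] that(2) by blast
    obtain x where "complete_solution X F x" "x 0 = y"
      by (rule complete_solution_exists[where F = F and D = D and \<Phi> = \<Phi>, OF ne tan bdd DX desc' assms(7) y])
    then show ?thesis by blast
  qed
  have "continuous_on U \<Phi>"
    using D by (intro continuous_at_imp_continuous_on) (auto intro: has_derivative_continuous)
  then have "stable_set X F Xhat" if "strict_minimizer_set X \<Phi> r Xhat"
    using mono by (intro strict_minimizer_imp_stable[OF assms(7) U _ assms(8,9) _ that]) auto
  moreover have "strict_minimizer_set X \<Phi> r Xhat" if "locally_asymptotically_stable X F Xhat"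
    by (rule asymptotically_stable_imp_strict_minimizer[OF U D assms(8,9) ex mono crit that])
  ultimately show ?thesis by blast
qed

end
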